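(* There exists a sequence of quadratic transforms along $\nu^*$ $$S=S_0\to S_1\to\cdots\to S_{k_1-1}\to S_{k_1}\to S_{k_1+1}\to\cdots\to S_{k_i}\to\cdots$$ such that for all $i>0$, $S_{k_i}$ is free and has a system of regular parameters $(x_i,y_i)$ such that $x_i$ is an exceptional parameter, $T_j=x_i^{Q_i\beta_j}\gamma_{j,i}$ for $0\le j\le i$ with $\gamma_{j,i}\in S_{k_i}$ a unit, $\nu^*(x_i)=\frac1{Q_i}$, $y_i=\frac{T_{i+1}}{\prod_{j=0}^{i-1}T_j^{n_{i,j}}}$ is the strict transform of $T_{i+1}$ in $S_{k_i}$, and $\nu^*(y_i)=\frac1{Q_i}\cdot\frac{p_{i+1}}{q_{i+1}}$.
   Context: Setting: $k$ (the base field) is algebraically closed of characteristic $0$; $\nu^*$ is a $k$-valuation of a function field $K^*$ of transcendence degree $2$ with valuation ring $V^*$, value group a subgroup of $\mathbb{Q}$ and residue field $k$; $S$ is an algebraic two-dimensional regular local ring with quotient field $K^*$ dominated by $V^*$, with regular parameters $(x,y)$, and $\nu^*(x)=1$. A quadratic transform along $\nu^*$ of a two-dimensional regular local ring $A$ with regular parameters $(a_1,a_2)$ is $A[m_A/a_i]$ localized at its intersection with $m_{V^*}$, chosen so it is dominated by $V^*$. Let $E$ be the curve $x=0$ on $\operatorname{Spec}S$; for $S_j$ in the sequence with $\pi_j:\operatorname{Spec}S_j\to\operatorname{Spec}S$, $S_j$ is free if $\pi_j^{-1}(E)_{\mathrm{red}}$ has exactly one irreducible component, and a regular parameter of a free $S_j$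 is exceptional if it is supported on $\pi_j^{-1}(E)_{\mathrm{red}}$. Jumping polynomials: $T_0=x$, $T_1=y$, $q_0=\infty$, $p_1,q_1$ coprime positive integers with $\nu^*(y)=p_1/q_1$; for $i\ge1$, $n_{i,j}$ ($0\le j<i$) are nonnegative integers with $n_{i,j}<q_j$ and $q_i\nu^*(T_i)=\sum_{j<i}n_{i,j}\nu^*(T_j)$, $\lambda_i\in k$ is the residue of $T_i^{q_i}/\prod_{j<i}T_j^{n_{i,j}}$, $T_{i+1}=T_i^{q_i}-\lambda_i\prod_{j<i}T_j^{n_{i,j}}$, and $p_{i+1},q_{i+1}$ are coprime positive integers with $\nu^*(T_{i+1})=q_i\nu^*(T_i)+\frac{1}{q_1\cdots q_i}\frac{p_{i+1}}{q_{i+1}}$. Put $\beta_i=\nu^*(T_i)$, $Q_i=q_1\cdots q_i$. For coprime positive $p,q$, $\epsilon(p,q)$ is the sum $f_1+\cdots+f_N$ of the quotients in the Euclidean algorithm $r_0=p$, $r_1=q$, $r_{j-1}=f_jr_j+r_{j+1}$. Set $k_0=0$, $k_i=k_{i-1}+\epsilon(p_i,q_i)$. *)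

theory Defs
  imports "HOL-Computational_Algebra.Polynomial"
begin

text \<open>The function field K* is modelled as the whole type 'a (a field of characteristic 0);
  the base field k, the local rings, ideals etc. are subsets of 'a.\<close>

definition subring :: "'a::field set \<Rightarrow> bool" where
  "subring R \<longleftrightarrow> 0 \<in> R \<and> 1 \<in> R \<and> (\<forall>a\<in>R. \<forall>b\<in>R. a + b \<in> R \<and> a - b \<in> R \<and> a * b \<in> R)"

definition subfield :: "'a::field set \<Rightarrow> bool" where
  "subfield R \<longleftrightarrow> subring R \<and> (\<forall>a\<in>R. a \<noteq> 0 \<longrightarrow> inverse a \<in> R)"

definition gen_subring :: "'a::field set \<Rightarrow> 'a set" where
  "gen_subring X = \<Inter>{R. subring R \<and> X \<subseteq> R}"

definition gen_subfield :: "'a::field set \<Rightarrow> 'a set" where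
  "gen_subfield X = \<Inter>{R. subfield R \<and> X \<subseteq> R}"

definition is_ideal :: "'a::field set \<Rightarrow> 'a set \<Rightarrow> bool" where
  "is_ideal I R \<longleftrightarrow> I \<subseteq> R \<and> 0 \<in> I \<and> (\<forall>a\<in>I. \<forall>b\<in>I. a + b \<in> I) \<and> (\<forall>r\<in>R. \<forall>a\<in>I. r * a \<in> I)"

definition gen_ideal :: "'a::field set \<Rightarrow> 'a set \<Rightarrow> 'a set" where
  "gen_ideal R X = \<Inter>{I. is_ideal I R \<and> X \<subseteq> I}"

definition prime_ideal :: "'a::field set \<Rightarrow> 'a set \<Rightarrow> bool" where
  "prime_ideal P R \<longleftrightarrow> is_ideal P R \<and> 1 \<notin> P \<and> (\<forall>a\<in>R. \<forall>b\<in>R. a * b \<in> P \<longrightarrow> a \<in> P \<or> b \<in> P)"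

definition noetherian :: "'a::field set \<Rightarrow> bool" where
  "noetherian R \<longleftrightarrow> (\<forall>I. is_ideal I R \<longrightarrow> (\<exists>F. finite F \<and> F \<subseteq> I \<and> I = gen_ideal R F))"

definition unit_in :: "'a::field set \<Rightarrow> 'a \<Rightarrow> bool" where
  "unit_in R a \<longleftrightarrow> a \<in> R \<and> a \<noteq> 0 \<and> inverse a \<in> R"

definition max_ideal :: "'a::field set \<Rightarrow> 'a set" where
  "max_ideal R = {a \<in> R. \<not> unit_in R a}"

definition local_ring :: "'a::field set \<Rightarrow> bool" where
  "local_ring R \<longleftrightarrow> subring R \<and> is_ideal (max_ideal R) R"

definition prime_chain :: "'a::field set \<Rightarrow> 'a set list \<Rightarrow> bool" where
  "prime_chain R Ps \<longleftrightarrow> (\<forall>P\<in>set Ps. prime_ideal P R) \<and> sorted_wrt (\<subset>) Ps"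

definition krull_dim_eq :: "'a::field set \<Rightarrow> nat \<Rightarrow> bool" where
  "krull_dim_eq R d \<longleftrightarrow> (\<exists>Ps. prime_chain R Ps \<and> length Ps = d + 1)
      \<and> (\<forall>Ps. prime_chain R Ps \<longrightarrow> length Ps \<le> d + 1)"

definition regular_params :: "'a::field set \<Rightarrow> 'a \<Rightarrow> 'a \<Rightarrow> bool" where
  "regular_params R a b \<longleftrightarrow> local_ring R \<and> noetherian R \<and> krull_dim_eq R 2
     \<and> a \<in> R \<and> b \<in> R \<and> max_ideal R = gen_ideal R {a, b}"

definition localization :: "'a::field set \<Rightarrow> 'a set \<Rightarrow> 'a set" where
  "localization A P = {a / s | a s. a \<in> A \<and> s \<in> A \<and> s \<notin> P}"

definition quotient_field_is_UNIV :: "'a::field set \<Rightarrow> bool" where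
  "quotient_field_is_UNIV R \<longleftrightarrow> (\<forall>z. \<exists>a\<in>R. \<exists>b\<in>R. b \<noteq> 0 \<and> z = a / b)"

definition algebraic_local_ring :: "'a::field set \<Rightarrow> 'a set \<Rightarrow> bool" where
  "algebraic_local_ring k R \<longleftrightarrow> (\<exists>F P. finite F \<and> prime_ideal P (gen_subring (k \<union> F))
       \<and> R = localization (gen_subring (k \<union> F)) P)"

definition alg_closed_subfield :: "'a::field set \<Rightarrow> bool" where
  "alg_closed_subfield k \<longleftrightarrow> subfield k \<and>
     (\<forall>p::'a poly. (\<forall>i. coeff p i \<in> k) \<and> degree p \<ge> 1 \<longrightarrow> (\<exists>z\<in>k. poly p z = 0))"

definition algebraic_over :: "'a::field set \<Rightarrow> 'a \<Rightarrow> bool" where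
  "algebraic_over L z \<longleftrightarrow> (\<exists>p::'a poly. p \<noteq> 0 \<and> (\<forall>i. coeff p i \<in> L) \<and> poly p z = 0)"

definition alg_indep2 :: "'a::field set \<Rightarrow> 'a \<Rightarrow> 'a \<Rightarrow> bool" where
  "alg_indep2 k u v \<longleftrightarrow> (\<forall>N c. (\<forall>i j. c i j \<in> k) \<and> (\<Sum>i<N. \<Sum>j<N. c i j * u ^ i * v ^ j) = 0
      \<longrightarrow> (\<forall>i<N. \<forall>j<N. c i j = 0))"

definition function_field_trdeg2 :: "'a::field set \<Rightarrow> bool" where
  "function_field_trdeg2 k \<longleftrightarrow> (\<exists>F. finite F \<and> gen_subfield (k \<union> F) = UNIV)
     \<and> (\<exists>u v. alg_indep2 k u v \<and> (\<forall>z. algebraic_over (gen_subfield (k \<union> {u, v})) z))"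

text \<open>A k-valuation with values in the rationals (the value at 0 is irrelevant).\<close>
definition k_valuation :: "'a::field set \<Rightarrow> ('a \<Rightarrow> rat) \<Rightarrow> bool" where
  "k_valuation k \<nu> \<longleftrightarrow> (\<forall>a b. a \<noteq> 0 \<longrightarrow> b \<noteq> 0 \<longrightarrow> \<nu> (a * b) = \<nu> a + \<nu> b)
     \<and> (\<forall>a b. a \<noteq> 0 \<longrightarrow> b \<noteq> 0 \<longrightarrow> a + b \<noteq> 0 \<longrightarrow> \<nu> (a + b) \<ge> min (\<nu> a) (\<nu> b))
     \<and> (\<forall>c\<in>k. c \<noteq> 0 \<longrightarrow> \<nu> c = 0)"

definition val_ring :: "('a::field \<Rightarrow> rat) \<Rightarrow> 'a set" where
  "val_ring \<nu> = {a. a = 0 \<or> \<nu> a \<ge> 0}"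

definition val_max :: "('a::field \<Rightarrow> rat) \<Rightarrow> 'a set" where
  "val_max \<nu> = {a. a = 0 \<or> \<nu> a > 0}"

text \<open>c is the residue of w (residue field identified with k).\<close>
definition residue_is :: "('a::field \<Rightarrow> rat) \<Rightarrow> 'a set \<Rightarrow> 'a \<Rightarrow> 'a \<Rightarrow> bool" where
  "residue_is \<nu> k w c \<longleftrightarrow> c \<in> k \<and> w - c \<in> val_max \<nu>"

definition residue_field_k :: "('a::field \<Rightarrow> rat) \<Rightarrow> 'a set \<Rightarrow> bool" where
  "residue_field_k \<nu> k \<longleftrightarrow> (\<forall>a\<in>val_ring \<nu>. \<exists>c. residue_is \<nu> k a c)"

definition dominated :: "'a::field set \<Rightarrow> ('a \<Rightarrow> rat) \<Rightarrow> bool" where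
  "dominated R \<nu> \<longleftrightarrow> R \<subseteq> val_ring \<nu> \<and> max_ideal R \<subseteq> val_max \<nu>"

definition quadratic_transform :: "('a::field \<Rightarrow> rat) \<Rightarrow> 'a set \<Rightarrow> 'a set \<Rightarrow> bool" where
  "quadratic_transform \<nu> A A' \<longleftrightarrow> (\<exists>a1 a2. regular_params A a1 a2 \<and>
     (\<exists>a\<in>{a1, a2}. A' = localization (gen_subring (A \<union> {z / a | z. z \<in> max_ideal A}))
                          (gen_subring (A \<union> {z / a | z. z \<in> max_ideal A}) \<inter> val_max \<nu>))
     \<and> dominated A' \<nu>)"

definition minimal_primes_over :: "'a::field set \<Rightarrow> 'a set \<Rightarrow> 'a set set" where
  "minimal_primes_over R I = {P. prime_ideal P R \<and> I \<subseteq> P \<and>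
      (\<forall>Q. prime_ideal Q R \<and> I \<subseteq> Q \<and> Q \<subseteq> P \<longrightarrow> Q = P)}"

text \<open>R (dominating S) is free w.r.t. the curve E : x = 0 if the reduced preimage of E,
  i.e. V(xR), has exactly one irreducible component (minimal prime over xR).\<close>
definition free :: "'a::field set \<Rightarrow> 'a \<Rightarrow> bool" where
  "free R x \<longleftrightarrow> (\<exists>!P. P \<in> minimal_primes_over R (gen_ideal R {x}))"

text \<open>z is supported on the preimage of E: V(z) is contained in V(x).\<close>
definition exceptional :: "'a::field set \<Rightarrow> 'a \<Rightarrow> 'a \<Rightarrow> bool" where
  "exceptional R x z \<longleftrightarrow> (\<forall>P. prime_ideal P R \<longrightarrow> z \<in> P \<longrightarrow> x \<in> P)"

text \<open>g is the strict transform of f in the free ring R with exceptional parameter e: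
  f = e^a * (unit) * g with g not divisible by e in R.\<close>
definition strict_transform :: "'a::field set \<Rightarrow> 'a \<Rightarrow> 'a \<Rightarrow> 'a \<Rightarrow> bool" where
  "strict_transform R e f g \<longleftrightarrow> g \<in> R \<and> (\<exists>(a::nat) u. unit_in R u \<and> f = e ^ a * u * g) \<and> g / e \<notin> R"

fun eps :: "nat \<Rightarrow> nat \<Rightarrow> nat" where
  "eps p q = (if q = 0 then 0 else p div q + eps q (p mod q))"

fun kseq :: "(nat \<Rightarrow> nat) \<Rightarrow> (nat \<Rightarrow> nat) \<Rightarrow> nat \<Rightarrow> nat" where
  "kseq p q 0 = 0"
| "kseq p q (Suc i) = kseq p q i + eps (p (Suc i)) (q (Suc i))"

definition Qp :: "(nat \<Rightarrow> nat) \<Rightarrow> nat \<Rightarrow> nat" where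
  "Qp q i = (\<Prod>l\<in>{1..i}. q l)"

definition jumping_polys :: "'a::field set \<Rightarrow> ('a \<Rightarrow> rat) \<Rightarrow> 'a \<Rightarrow> 'a \<Rightarrow> (nat \<Rightarrow> 'a)
     \<Rightarrow> (nat \<Rightarrow> nat) \<Rightarrow> (nat \<Rightarrow> nat) \<Rightarrow> (nat \<Rightarrow> nat \<Rightarrow> nat) \<Rightarrow> (nat \<Rightarrow> 'a) \<Rightarrow> bool" where
  "jumping_polys k \<nu> x y T p q n lam \<longleftrightarrow>
     T 0 = x \<and> T 1 = y \<and>
     p 1 > 0 \<and> q 1 > 0 \<and> coprime (p 1) (q 1) \<and> \<nu> y = of_nat (p 1) / of_nat (q 1) \<and>
     (\<forall>i\<ge>1.
        (\<forall>j. 1 \<le> j \<and> j < i \<longrightarrow> n i j < q j) \<and>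
        of_nat (q i) * \<nu> (T i) = (\<Sum>j<i. of_nat (n i j) * \<nu> (T j)) \<and>
        residue_is \<nu> k (T i ^ q i / (\<Prod>j<i. T j ^ n i j)) (lam i) \<and>
        T (Suc i) = T i ^ q i - lam i * (\<Prod>j<i. T j ^ n i j) \<and>
        p (Suc i) > 0 \<and> q (Suc i) > 0 \<and> coprime (p (Suc i)) (q (Suc i)) \<and>
        \<nu> (T (Suc i)) = of_nat (q i) * \<nu> (T i)
            + (1 / of_nat (Qp q i)) * (of_nat (p (Suc i)) / of_nat (q (Suc i))))"

end

theory Submission
  imports Defs
begin

text \<open>
  A quadratic transform of a ring with regular parameters \<open>(a, b)\<close>, \<open>\<nu> a \<le> \<nu> b\<close>, has the regular
  parameters \<open>(a, b / a - c)\<close>, where \<open>c\<close> is the residue of \<open>b / a\<close>. If \<open>\<nu> b / \<nu> a = p / q\<close> in lowest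
  terms, then following the Euclidean algorithm one reaches after \<open>eps p q\<close> such steps a ring with
  parameters \<open>(s, b ^ q / a ^ p - c)\<close> in which \<open>a\<close> and \<open>b\<close> are \<open>s ^ q\<close> and \<open>s ^ p\<close> times units.
  Applied to \<open>(x\<^sub>i, y\<^sub>i)\<close>, this makes every \<open>T j\<close>, \<open>j \<le> Suc i\<close>, a power of \<open>s\<close> times a unit, and the
  second parameter may be replaced by the next \<open>y\<^sub>i\<close>: the two quotients involved differ by a unit
  factor from the ring of stage \<open>i\<close>, and such a unit is a constant modulo \<open>s\<close>.
\<close>

subsection \<open>Ideals in noetherian local rings\<close>

text \<open>\<open>regular_params\<close> demands Krull dimension exactly two, so every blow-up must
  be shown to have dimension two again. To this end the dimension is turned into a statement about
  the pair of parameters: for a noetherian local ring A with maximal ideal (a, b) and a nonzero, it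
  amounts to aA being prime with b outside aA. One direction is a special case of Krull's principal
  ideal theorem, the other a classification of the primes as zero, principal or maximal. On the
  blow-up this criterion can be checked: the chart A[b / a] modulo a is a polynomial ring in one
  variable over the residue field, hence a domain in which b / a - c is not zero, and localization
  at the centre of \<nu> preserves both facts. Since the residue field is k, the centre is a
  rational point of the exceptional line, which is why c can be taken in k. The exponents with which
  the \<open>T j\<close> are powers of the exceptional parameter are not carried along; the values
  recover them.\<close>

lemma subring_zero: "subring R \<Longrightarrow> 0 \<in> R"
  and subring_one: "subring R \<Longrightarrow> 1 \<in> R"
  and subring_add: "subring R \<Longrightarrow> a \<in> R \<Longrightarrow> b \<in> R \<Longrightarrow> a + b \<in> R"
  and subring_diff: "subring R \<Longrightarrow> a \<in> R \<Longrightarrow> b \<in> R \<Longrightarrow> a - b \<in> R"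
  and subring_mult: "subring R \<Longrightarrow> a \<in> R \<Longrightarrow> b \<in> R \<Longrightarrow> a * b \<in> R"
  by (auto simp: subring_def)

lemma subring_uminus: "subring R \<Longrightarrow> a \<in> R \<Longrightarrow> - a \<in> R"
  using subring_diff[of R 0 a] subring_zero by auto

lemma subring_power: "subring R \<Longrightarrow> a \<in> R \<Longrightarrow> a ^ n \<in> R"
  by (induction n) (auto intro: subring_one subring_mult)

lemma subring_sum: "subring R \<Longrightarrow> (\<And>i. i \<in> I \<Longrightarrow> f i \<in> R) \<Longrightarrow> sum f I \<in> R"
  by (induction I rule: infinite_finite_induct) (auto intro: subring_zero subring_add)

lemmas subring_intros = subring_zero subring_one subring_add subring_diff subring_mult
  subring_uminus subring_power subring_sum

lemma ideal_subset: "is_ideal I R \<Longrightarrow> a \<in> I \<Longrightarrow> a \<in> R"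
  and ideal_zero: "is_ideal I R \<Longrightarrow> 0 \<in> I"
  and ideal_add: "is_ideal I R \<Longrightarrow> a \<in> I \<Longrightarrow> b \<in> I \<Longrightarrow> a + b \<in> I"
  and ideal_mult: "is_ideal I R \<Longrightarrow> r \<in> R \<Longrightarrow> a \<in> I \<Longrightarrow> r * a \<in> I"
  by (auto simp: is_ideal_def)

lemma ideal_mult_right: "is_ideal I R \<Longrightarrow> r \<in> R \<Longrightarrow> a \<in> I \<Longrightarrow> a * r \<in> I"
  using ideal_mult by (metis mult.commute)

lemma ideal_diff:
  assumes "subring R" "is_ideal I R" "a \<in> I" "b \<in> I"
  shows "a - b \<in> I"
  using ideal_add[OF assms(2,3) ideal_mult[OF assms(2) _ assms(4), of "-1"]] assms(1)
  by (auto intro: subring_intros)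

lemma ideal_sum: "is_ideal I R \<Longrightarrow> (\<And>i. i \<in> X \<Longrightarrow> f i \<in> I) \<Longrightarrow> sum f X \<in> I"
  by (induction X rule: infinite_finite_induct) (auto intro: ideal_zero ideal_add)

lemma is_ideal_Inter:
  assumes "X \<noteq> {}" "\<And>i. i \<in> X \<Longrightarrow> is_ideal (I i) R"
  shows "is_ideal (\<Inter>i\<in>X. I i) R"
  unfolding is_ideal_def
proof (intro conjI ballI)
  show "(\<Inter>i\<in>X. I i) \<subseteq> R" using assms ideal_subset by blast
qed (use ideal_zero[OF assms(2)] ideal_add[OF assms(2)] ideal_mult[OF assms(2)] in auto)

lemma principal_subset: "is_ideal I R \<Longrightarrow> a \<in> I \<Longrightarrow> (*) a ` R \<subseteq> I"
  by (auto intro: ideal_mult_right)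

lemma is_ideal_gen: "subring R \<Longrightarrow> X \<subseteq> R \<Longrightarrow> is_ideal (gen_ideal R X) R"
  unfolding gen_ideal_def is_ideal_def subring_def by blast

lemma gen_ideal_superset: "X \<subseteq> gen_ideal R X"
  by (auto simp: gen_ideal_def)

lemma gen_ideal_least: "is_ideal I R \<Longrightarrow> X \<subseteq> I \<Longrightarrow> gen_ideal R X \<subseteq> I"
  by (auto simp: gen_ideal_def)

lemma gen_ideal_eqI:
  assumes "is_ideal I R" "X \<subseteq> I" "\<And>K. is_ideal K R \<Longrightarrow> X \<subseteq> K \<Longrightarrow> I \<subseteq> K"
  shows "gen_ideal R X = I"
  using assms unfolding gen_ideal_def by blast

lemma is_ideal_principal: "subring R \<Longrightarrow> a \<in> R \<Longrightarrow> is_ideal ((*) a ` R) R"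
proof -
  assume R: "subring R" and a: "a \<in> R"
  have "a * r + a * s \<in> (*) a ` R" if "r \<in> R" "s \<in> R" for r s
    using that R by (intro image_eqI[of _ _ "r + s"]) (auto simp: algebra_simps intro: subring_intros)
  moreover have "t * (a * r) \<in> (*) a ` R" if "r \<in> R" "t \<in> R" for r t
    using that R by (intro image_eqI[of _ _ "t * r"]) (auto simp: algebra_simps intro: subring_intros)
  moreover have "0 \<in> (*) a ` R" using R by (intro image_eqI[of _ _ 0]) (auto intro: subring_intros)
  ultimately show ?thesis using R a by (auto simp: is_ideal_def intro: subring_intros)
qed

lemma mem_principal_iff: "a \<noteq> 0 \<Longrightarrow> z \<in> (*) a ` R \<longleftrightarrow> z / a \<in> (R :: 'a::field set)"
  by (auto simp: image_iff intro: bexI[of _ "z / a"])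

text \<open>\<open>gen_ideal\<close> is an intersection of ideals and exhibits no coefficients; this
  form does, and \<open>gen_ideal_pair\<close> identifies the two.\<close>

definition span2 :: "'a::field set \<Rightarrow> 'a \<Rightarrow> 'a \<Rightarrow> 'a set" where
  "span2 R a b = {a * r + b * s | r s. r \<in> R \<and> s \<in> R}"

lemma is_ideal_span2:
  assumes "subring R" "a \<in> R" "b \<in> R"
  shows "is_ideal (span2 R a b) R"
proof -
  have 1: "a * r + b * s + (a * r' + b * s') \<in> span2 R a b"
    if "r \<in> R" "s \<in> R" "r' \<in> R" "s' \<in> R" for r s r' s'
    unfolding span2_def mem_Collect_eq using that assms(1)
    by (intro exI[of _ "r + r'"] exI[of _ "s + s'"]) (auto simp: algebra_simps intro: subring_intros)
  have 2: "t * (a * r + b * s) \<in> span2 R a b"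
    if "r \<in> R" "s \<in> R" "t \<in> R" for r s t
    unfolding span2_def mem_Collect_eq using that assms(1)
    by (intro exI[of _ "t * r"] exI[of _ "t * s"]) (auto simp: algebra_simps intro: subring_intros)
  have 3: "0 \<in> span2 R a b"
    unfolding span2_def mem_Collect_eq using assms(1)
    by (intro exI[of _ 0] exI[of _ 0]) (auto intro: subring_intros)
  have 4: "span2 R a b \<subseteq> R"
    using assms by (auto simp: span2_def intro: subring_intros)
  show ?thesis
    unfolding is_ideal_def using 3 4
  proof (intro conjI ballI)
    fix z z' assume "z \<in> span2 R a b" "z' \<in> span2 R a b"
    then obtain r s r' s' where "z = a * r + b * s" "z' = a * r' + b * s'"
      "r \<in> R" "s \<in> R" "r' \<in> R" "s' \<in> R" unfolding span2_def by blast
    then show "z + z' \<in> span2 R a b" using 1 by simp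
  next
    fix t z assume "t \<in> R" "z \<in> span2 R a b"
    then obtain r s where "z = a * r + b * s" "r \<in> R" "s \<in> R" unfolding span2_def by blast
    then show "t * z \<in> span2 R a b" using 2 \<open>t \<in> R\<close> by simp
  qed auto
qed

lemma span2_gens:
  assumes "subring R"
  shows "a \<in> span2 R a b" "b \<in> span2 R a b"
proof -
  have "a = a * 1 + b * 0" "b = a * 0 + b * 1" by auto
  then show "a \<in> span2 R a b" "b \<in> span2 R a b"
    unfolding span2_def mem_Collect_eq using subring_zero[OF assms] subring_one[OF assms] by blast+
qed

lemma span2_subset: "is_ideal I R \<Longrightarrow> a \<in> I \<Longrightarrow> b \<in> I \<Longrightarrow> span2 R a b \<subseteq> I"
  by (auto simp: span2_def intro: ideal_add ideal_mult_right)

lemma gen_ideal_pair: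
  assumes "subring R" "a \<in> R" "b \<in> R"
  shows "gen_ideal R {a, b} = span2 R a b"
proof (rule gen_ideal_eqI[OF is_ideal_span2[OF assms]])
  show "{a, b} \<subseteq> span2 R a b" using span2_gens[OF assms(1)] by blast
qed (auto dest: span2_subset)

lemma noetherianI:
  assumes "subring R"
    and "\<And>I. is_ideal I R \<Longrightarrow> \<exists>F. finite F \<and> F \<subseteq> I \<and> I \<subseteq> gen_ideal R F"
  shows "noetherian R"
  unfolding noetherian_def
proof (intro allI impI)
  fix I assume I: "is_ideal I R"
  then obtain F where F: "finite F" "F \<subseteq> I" "I \<subseteq> gen_ideal R F" using assms(2)[OF I] by blast
  have "I = gen_ideal R F" by (rule equalityI[OF F(3) gen_ideal_least[OF I F(2)]])
  then show "\<exists>F. finite F \<and> F \<subseteq> I \<and> I = gen_ideal R F" by (intro exI[of _ F] conjI F(1,2))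
qed

text \<open>Zorn's lemma applies because a finite set generating the union of a nonempty chain
  already lies in one member, so that member is the union.\<close>

lemma noetherian_maximal:
  assumes R: "subring R" and noeth: "noetherian R" and ne: "\<I> \<noteq> {}"
    and ideals: "\<And>I. I \<in> \<I> \<Longrightarrow> is_ideal I R"
  obtains M where "M \<in> \<I>" "\<And>J. J \<in> \<I> \<Longrightarrow> M \<subseteq> J \<Longrightarrow> J = M"
proof -
  have "\<exists>M\<in>\<I>. \<forall>X\<in>\<I>. M \<subseteq> X \<longrightarrow> X = M"
  proof (rule subset_Zorn)
    fix C assume C: "subset.chain \<I> C"
    show "\<exists>U\<in>\<I>. \<forall>X\<in>C. X \<subseteq> U"
    proof (cases "C = {}")
      case True
      then show ?thesis using ne by blast
    next
      case False
      have C\<I>: "X \<in> \<I>" if "X \<in> C" for X using C that by (auto simp: subset.chain_def)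
      have lin: "X \<subseteq> Y \<or> Y \<subseteq> X" if "X \<in> C" "Y \<in> C" for X Y
        using C that by (auto simp: subset_chain_def)
      have "is_ideal (\<Union>C) R"
        unfolding is_ideal_def
      proof (intro conjI ballI)
        show "\<Union>C \<subseteq> R" using C\<I> ideals ideal_subset by blast
        show "0 \<in> \<Union>C" using False C\<I> ideals ideal_zero by blast
      next
        fix a b assume "a \<in> \<Union>C" "b \<in> \<Union>C"
        then obtain X where "X \<in> C" "a \<in> X" "b \<in> X" using lin by blast
        then show "a + b \<in> \<Union>C" using C\<I> ideals ideal_add by blast
      next
        fix r a assume "r \<in> R" "a \<in> \<Union>C"
        then show "r * a \<in> \<Union>C" using C\<I> ideals ideal_mult by blast
      qed
      then obtain F where F: "finite F" "F \<subseteq> \<Union>C" "\<Union>C = gen_ideal R F"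
        using noeth[unfolded noetherian_def, rule_format, of "\<Union>C"] by blast
      obtain X where X: "X \<in> C" "F \<subseteq> X"
        using finite_subset_Union_chain[OF F(1,2) False C] by blast
      have "\<Union>C \<subseteq> X" unfolding F(3) using X C\<I> ideals gen_ideal_least by blast
      then show ?thesis using X C\<I> by blast
    qed
  qed
  then show ?thesis using that by blast
qed

lemma noetherian_chain_stable:
  fixes I :: "nat \<Rightarrow> 'a::field set"
  assumes "subring R" "noetherian R" "\<And>n. is_ideal (I n) R" "\<And>n. I n \<subseteq> I (Suc n)"
  obtains N where "\<And>n. N \<le> n \<Longrightarrow> I n = I N"
proof -
  obtain M where M: "M \<in> range I" "\<And>J. J \<in> range I \<Longrightarrow> M \<subseteq> J \<Longrightarrow> J = M"
    using noetherian_maximal[OF assms(1,2), of "range I"] assms(3) by blast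
  then obtain N where N: "M = I N" by blast
  have "I n = I N" if "N \<le> n" for n
    using M(2)[of "I n"] lift_Suc_mono_le[of I, OF assms(4) that] N by blast
  then show ?thesis using that by blast
qed

section \<open>Local rings and Nakayama's lemma\<close>

lemma local_subring: "local_ring A \<Longrightarrow> subring A"
  by (simp add: local_ring_def)

lemma max_ideal_ideal: "local_ring A \<Longrightarrow> is_ideal (max_ideal A) A"
  by (simp add: local_ring_def)

lemma one_notin_max_ideal: "1 \<notin> max_ideal A"
  by (auto simp: max_ideal_def unit_in_def)

lemma unit_iff_not_max: "u \<in> A \<Longrightarrow> unit_in A u \<longleftrightarrow> u \<notin> max_ideal A"
  by (auto simp: max_ideal_def)

lemma unit_in_mult: "subring A \<Longrightarrow> unit_in A u \<Longrightarrow> unit_in A v \<Longrightarrow> unit_in A (u * v)"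
  by (auto simp: unit_in_def nonzero_inverse_mult_distrib intro: subring_intros)

lemma unit_in_inverse: "unit_in A u \<Longrightarrow> unit_in A (inverse u)"
  by (auto simp: unit_in_def)

lemma unit_in_divide: "subring A \<Longrightarrow> unit_in A u \<Longrightarrow> unit_in A v \<Longrightarrow> unit_in A (u / v)"
  using unit_in_mult[of A u "inverse v"] unit_in_inverse[of A v] by (simp add: divide_inverse)

lemma unit_in_power: "subring A \<Longrightarrow> unit_in A u \<Longrightarrow> unit_in A (u ^ n)"
  by (auto simp: unit_in_def power_inverse[symmetric] intro: subring_intros)

lemma unit_in_one: "subring A \<Longrightarrow> unit_in A 1"
  by (auto simp: unit_in_def intro: subring_intros)

lemma unit_in_mono: "unit_in A u \<Longrightarrow> A \<subseteq> B \<Longrightarrow> unit_in B u"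
  by (auto simp: unit_in_def)

lemma max_ideal_prime:
  assumes "local_ring A"
  shows "prime_ideal (max_ideal A) A"
  unfolding prime_ideal_def
proof (intro conjI ballI impI)
  show "is_ideal (max_ideal A) A" "1 \<notin> max_ideal A"
    using assms max_ideal_ideal one_notin_max_ideal by blast+
  fix a b assume "a \<in> A" "b \<in> A" "a * b \<in> max_ideal A"
  then show "a \<in> max_ideal A \<or> b \<in> max_ideal A"
    using unit_in_mult[OF local_subring[OF assms], of a b] by (auto simp: max_ideal_def)
qed

lemma proper_ideal_le_max:
  assumes "is_ideal I A" "1 \<notin> I"
  shows "I \<subseteq> max_ideal A"
proof
  fix z assume "z \<in> I"
  then show "z \<in> max_ideal A"
    using assms ideal_mult[OF assms(1), of "inverse z" z] ideal_subset[OF assms(1)]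
    by (auto simp: max_ideal_def unit_in_def)
qed

lemma prime_power_mem:
  assumes "prime_ideal P R" "subring R" "a \<in> R" "a ^ n \<in> P"
  shows "a \<in> P"
  using assms(4)
proof (induction n)
  case 0
  then show ?case using assms(1) by (simp add: prime_ideal_def)
next
  case (Suc n)
  then show ?case
    using assms(1-3) subring_power[of R a n] by (auto simp: prime_ideal_def)
qed

text \<open>In place of the determinant trick, J + gA is chosen maximal among these ideals with g in
  I outside J. Writing g = j + a h gives J + gA inside J + hA with h outside J, so the two agree and
  h = j' + r g. Then (1 - r a) h lies in J although 1 - r a is a unit, a contradiction.\<close>

lemma nakayama:
  assumes loc: "local_ring A" and noeth: "noetherian A" and a: "a \<in> max_ideal A"
    and I: "is_ideal I A" and J: "is_ideal J A"
    and sub: "\<And>g. g \<in> I \<Longrightarrow> \<exists>j\<in>J. \<exists>h\<in>I. g = j + a * h"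
  shows "I \<subseteq> J"
proof (rule ccontr)
  assume "\<not> I \<subseteq> J"
  have A: "subring A" using loc by (rule local_subring)
  have aA: "a \<in> A" using a by (simp add: max_ideal_def)
  define K where "K g = {j + r * g | j r. j \<in> J \<and> r \<in> A}" for g
  have mem: "j + r * g \<in> K g" if "j \<in> J" "r \<in> A" for j r g
    using that unfolding K_def by blast
  have JK: "J \<subseteq> K g" and gK: "g \<in> K g" for g
    using mem[of _ 0 g] mem[of 0 1 g] A ideal_zero[OF J] by (auto intro: subring_intros)
  have K: "is_ideal (K g) A" if g: "g \<in> I" for g
    unfolding is_ideal_def
  proof (intro conjI ballI)
    show "K g \<subseteq> A"
      using g A ideal_subset[OF I] ideal_subset[OF J] by (auto simp: K_def intro: subring_intros)
    show "0 \<in> K g" using JK ideal_zero[OF J] by blast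
  next
    fix u v assume "u \<in> K g" "v \<in> K g"
    then obtain j r j' r' where "u = j + r * g" "v = j' + r' * g" "j \<in> J" "j' \<in> J" "r \<in> A" "r' \<in> A"
      unfolding K_def by blast
    then show "u + v \<in> K g"
      using mem[of "j + j'" "r + r'" g] ideal_add[OF J] subring_add[OF A] by (simp add: algebra_simps)
  next
    fix t u assume "t \<in> A" "u \<in> K g"
    then obtain j r where "u = j + r * g" "j \<in> J" "r \<in> A" unfolding K_def by blast
    then show "t * u \<in> K g"
      using mem[of "t * j" "t * r" g] ideal_mult[OF J \<open>t \<in> A\<close>] subring_mult[OF A \<open>t \<in> A\<close>]
      by (simp add: algebra_simps)
  qed
  obtain M where M: "M \<in> K ` (I - J)" "\<And>N. N \<in> K ` (I - J) \<Longrightarrow> M \<subseteq> N \<Longrightarrow> N = M"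
    using noetherian_maximal[OF A noeth, of "K ` (I - J)"] K \<open>\<not> I \<subseteq> J\<close> by blast
  then obtain g where g: "g \<in> I" "g \<notin> J" "M = K g" by blast
  obtain j h where jh: "j \<in> J" "h \<in> I" "g = j + a * h" using sub g by blast
  have hJ: "h \<notin> J" using jh g ideal_add[OF J] ideal_mult[OF J aA] by blast
  have "M \<subseteq> K h"
  proof
    fix z assume "z \<in> M"
    then obtain j' r where z: "z = j' + r * g" "j' \<in> J" "r \<in> A" unfolding g(3) K_def by blast
    have "z = (j' + r * j) + (r * a) * h" "j' + r * j \<in> J" "r * a \<in> A"
      subgoal using z jh by (simp add: algebra_simps)
      using jh z ideal_add[OF J] ideal_mult[OF J] subring_mult[OF A _ aA] by blast+
    then show "z \<in> K h" using mem by blast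
  qed
  then have "h \<in> K g" using M(2) hJ jh(2) gK g(3) by blast
  then obtain j' r where r: "h = j' + r * g" "j' \<in> J" "r \<in> A" unfolding K_def by blast
  have "1 - r * a \<notin> max_ideal A"
  proof
    assume "1 - r * a \<in> max_ideal A"
    then have "1 - r * a + r * a \<in> max_ideal A"
      using ideal_add ideal_mult max_ideal_ideal[OF loc] a r(3) by metis
    then show False by (simp add: one_notin_max_ideal)
  qed
  then have u: "unit_in A (1 - r * a)"
    using unit_iff_not_max[of "1 - r * a" A] A aA r(3) by (auto intro: subring_intros)
  have "(1 - r * a) * h = j' + r * j" using r(1) jh(3) by (simp add: algebra_simps)
  then have "h = inverse (1 - r * a) * (j' + r * j)" using u by (auto simp: unit_in_def field_simps)
  moreover have "inverse (1 - r * a) * (j' + r * j) \<in> J"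
    using u r jh ideal_add[OF J] ideal_mult[OF J] by (simp add: unit_in_def)
  ultimately show False using hJ by simp
qed

subsection \<open>Regular parameters of two-dimensional local rings\<close>

locale two_gen_local =
  fixes A :: "'a::field set" and a b :: 'a
  assumes loc: "local_ring A" and noeth: "noetherian A" and gens: "max_ideal A = span2 A a b"
begin

lemma A: "subring A" using loc by (rule local_subring)

lemma a_max: "a \<in> max_ideal A" and b_max: "b \<in> max_ideal A"
  using span2_gens[OF A] gens by auto

lemma aA: "a \<in> A" and bA: "b \<in> A"
  using a_max b_max by (auto simp: max_ideal_def)

lemma pa: "is_ideal ((*) a ` A) A" by (rule is_ideal_principal[OF A aA])

lemma one_notin_pa: "1 \<notin> (*) a ` A"
  using a_max ideal_mult_right[OF max_ideal_ideal[OF loc] _ a_max] one_notin_max_ideal by force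

text \<open>Successive division by b modulo a: a last coefficient in (a, b) allows one more step,
  any other is a unit and stops the process at its power of b.\<close>

lemma expansion:
  assumes z: "z \<in> A"
  shows "(\<exists>r\<in>A. \<exists>s\<in>A. z = a * r + b ^ n * s)
    \<or> (\<exists>m<n. \<exists>r\<in>A. \<exists>u. unit_in A u \<and> z = a * r + b ^ m * u)"
proof (induction n)
  case 0
  have "z = a * 0 + b ^ 0 * z" by simp
  then show ?case using z subring_zero[OF A] by blast
next
  case (Suc n)
  then show ?case
  proof
    assume "\<exists>r\<in>A. \<exists>s\<in>A. z = a * r + b ^ n * s"
    then obtain r s where rs: "r \<in> A" "s \<in> A" "z = a * r + b ^ n * s" by blast
    show ?thesis
    proof (cases "s \<in> max_ideal A")
      case True
      then obtain r' s' where "r' \<in> A" "s' \<in> A" "s = a * r' + b * s'"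
        unfolding gens span2_def by blast
      then have "z = a * (r + b ^ n * r') + b ^ Suc n * s'" "r + b ^ n * r' \<in> A" "s' \<in> A"
        using rs A bA by (auto simp: algebra_simps intro: subring_intros)
      then show ?thesis by blast
    next
      case False
      then show ?thesis using rs unit_iff_not_max by blast
    qed
  next
    assume "\<exists>m<n. \<exists>r\<in>A. \<exists>u. unit_in A u \<and> z = a * r + b ^ m * u"
    then show ?thesis by (meson less_Suc_eq)
  qed
qed

text \<open>The ascending chain of annihilators of \<open>b ^ n\<close> modulo \<open>a\<close> replaces the Artin-Rees lemma.\<close>
lemma krull_intersection:
  assumes z: "z \<in> A" and all: "\<And>n. \<exists>r\<in>A. \<exists>s\<in>A. z = a * r + b ^ n * s"
  shows "z \<in> (*) a ` A"
proof -
  define ann where "ann n = {r \<in> A. b ^ n * r \<in> (*) a ` A}" for n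
  have "is_ideal (ann n) A" for n
    unfolding is_ideal_def ann_def
    using A aA bA ideal_zero[OF pa] ideal_add[OF pa] ideal_mult[OF pa]
    by (auto simp: distrib_left mult.left_commute[of "b ^ n"] intro: subring_intros)
  moreover have "ann n \<subseteq> ann (Suc n)" for n
    unfolding ann_def using ideal_mult[OF pa bA] by (auto simp: mult.assoc)
  ultimately obtain N where N: "\<And>n. N \<le> n \<Longrightarrow> ann n = ann N"
    using noetherian_chain_stable[OF A noeth, of ann] by blast
  define I where "I = (\<Inter>n. span2 A a (b ^ n))"
  have Imem: "z \<in> I \<longleftrightarrow> (\<forall>n. \<exists>r\<in>A. \<exists>s\<in>A. z = a * r + b ^ n * s)" for z
    unfolding I_def span2_def by blast
  have I: "is_ideal I A"
    unfolding I_def using A aA bA by (intro is_ideal_Inter is_ideal_span2 subring_intros) auto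
  have "I \<subseteq> (*) a ` A"
  proof (rule nakayama[OF loc noeth b_max I pa])
    fix g assume g: "g \<in> I"
    then obtain r1 h1 where 1: "r1 \<in> A" "h1 \<in> A" "g = a * r1 + b ^ Suc N * h1"
      unfolding Imem by blast
    \<comment> \<open>The order Suc N leaves one factor b to spare: comparing with the expansions of
      higher order and using that \<open>ann (Suc N)\<close> is \<open>ann N\<close> puts
      \<open>b ^ N * h1\<close> into I, so g lies in aA + bI, as Nakayama's lemma requires.\<close>
    have "b ^ N * h1 \<in> I"
      unfolding Imem
    proof
      fix n
      obtain r2 h2 where 2: "r2 \<in> A" "h2 \<in> A" "g = a * r2 + b ^ (Suc N + n) * h2"
        using g unfolding Imem by blast
      have "b ^ Suc N * (h1 - b ^ n * h2) = a * (r2 - r1)"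
        using 1(3) 2(3) by (simp add: algebra_simps power_add)
      moreover have "r2 - r1 \<in> A" "h1 - b ^ n * h2 \<in> A"
        using 1(1,2) 2(1,2) A bA by (blast intro: subring_intros)+
      ultimately have "h1 - b ^ n * h2 \<in> ann (Suc N)"
        unfolding ann_def by blast
      then have "h1 - b ^ n * h2 \<in> ann N" using N[of "Suc N"] by simp
      then obtain r3 where "r3 \<in> A" "b ^ N * (h1 - b ^ n * h2) = a * r3" unfolding ann_def by blast
      then have "b ^ N * h1 = a * r3 + b ^ n * (b ^ N * h2)" by (simp add: algebra_simps)
      then show "\<exists>r\<in>A. \<exists>s\<in>A. b ^ N * h1 = a * r + b ^ n * s"
        using \<open>r3 \<in> A\<close> 2(2) A bA by (meson subring_mult subring_power)
    qed
    moreover have "g = a * r1 + b * (b ^ N * h1)" using 1(3) by simp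
    ultimately show "\<exists>j\<in>(*) a ` A. \<exists>h\<in>I. g = j + b * h" using 1(1) by blast
  qed
  then show ?thesis using all Imem by blast
qed

text \<open>Modulo a the ring behaves like a discrete valuation ring with uniformizer b, except that
  b may still be nilpotent there.\<close>

lemma unit_expansion:
  assumes "z \<in> A" "z \<notin> (*) a ` A"
  obtains m r u where "r \<in> A" "unit_in A u" "z = a * r + b ^ m * u"
proof -
  obtain n where "\<not> (\<exists>r\<in>A. \<exists>s\<in>A. z = a * r + b ^ n * s)"
    using krull_intersection[OF assms(1)] assms(2) by blast
  then show ?thesis using expansion[OF assms(1), of n] that by blast
qed

text \<open>If \<open>b\<close> is nilpotent modulo \<open>a\<close>, the ideals containing \<open>a\<close> are the finitely many
  \<open>(a, b ^ m)\<close>, and Krull's principal ideal theorem holds with the contractions of \<open>f ^ n A\<^sub>P\<close>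
  in place of symbolic powers.\<close>
lemma prime_trivial_if_nilpotent:
  assumes nil: "b ^ N \<in> (*) a ` A" and P: "prime_ideal P A" and f: "f \<in> P" "f \<noteq> 0"
  shows "P = max_ideal A"
proof (cases "a \<in> P")
  case True
  have PI: "is_ideal P A" using P by (simp add: prime_ideal_def)
  have "b ^ N \<in> P" using nil principal_subset[OF PI True] by blast
  then have "b \<in> P" using prime_power_mem[OF P A bA] by blast
  then have "span2 A a b \<subseteq> P" by (rule span2_subset[OF PI True])
  moreover have "P \<subseteq> max_ideal A"
    using P by (intro proper_ideal_le_max) (auto simp: prime_ideal_def)
  ultimately show ?thesis using gens by blast
next
  case False
  have PI: "is_ideal P A" and P1: "1 \<notin> P"
    and Pm: "\<And>u v. u \<in> A \<Longrightarrow> v \<in> A \<Longrightarrow> u * v \<in> P \<Longrightarrow> u \<in> P \<or> v \<in> P"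
    using P by (auto simp: prime_ideal_def)
  have fA: "f \<in> A" using ideal_subset[OF PI f(1)] .
  define J where "J n = {g \<in> A. \<exists>s\<in>A. s \<notin> P \<and> (\<exists>h\<in>A. s * g = f ^ n * h)}" for n
  have J: "is_ideal (J n) A" for n
    unfolding is_ideal_def
  proof (intro conjI ballI)
    show "J n \<subseteq> A" by (auto simp: J_def)
    show "0 \<in> J n" unfolding J_def mem_Collect_eq
      by (intro conjI bexI[of _ 1] bexI[of _ 0]) (use A P1 in \<open>auto intro: subring_intros\<close>)
  next
    fix g g' assume "g \<in> J n" "g' \<in> J n"
    then obtain s h s' h' where *: "g \<in> A" "g' \<in> A" "s \<in> A" "s' \<in> A" "s \<notin> P" "s' \<notin> P" "h \<in> A" "h' \<in> A"
      "s * g = f ^ n * h" "s' * g' = f ^ n * h'" unfolding J_def by blast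
    have "(s * s') * (g + g') = s' * (s * g) + s * (s' * g')" by (simp add: algebra_simps)
    also have "\<dots> = f ^ n * (s' * h + s * h')" unfolding *(9,10) by (simp add: algebra_simps)
    finally show "g + g' \<in> J n" unfolding J_def mem_Collect_eq
      by (intro conjI bexI[of _ "s * s'"] bexI[of _ "s' * h + s * h'"])
         (use * A Pm[OF *(3,4)] in \<open>auto intro: subring_intros\<close>)
  next
    fix r g assume "r \<in> A" "g \<in> J n"
    then obtain s h where *: "g \<in> A" "s \<in> A" "s \<notin> P" "h \<in> A" "s * g = f ^ n * h"
      unfolding J_def by blast
    have "s * (r * g) = r * (s * g)" by (simp add: algebra_simps)
    also have "\<dots> = f ^ n * (r * h)" unfolding *(5) by (simp add: algebra_simps)
    finally show "r * g \<in> J n" unfolding J_def mem_Collect_eq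
      by (intro conjI bexI[of _ s] bexI[of _ "r * h"])
         (use * \<open>r \<in> A\<close> A in \<open>auto intro: subring_intros\<close>)
  qed
  have Jdec: "J (Suc n) \<subseteq> J n" for n
  proof
    fix g assume "g \<in> J (Suc n)"
    then obtain s h where "g \<in> A" "s \<in> A" "s \<notin> P" "h \<in> A" "s * g = f ^ n * (f * h)"
      unfolding J_def by (auto simp: mult_ac)
    then show "g \<in> J n" unfolding J_def using A fA by (blast intro: subring_mult)
  qed
  \<comment> \<open>a lies outside P, so it can be absorbed into the denominator s.\<close>
  have Ja: "r \<in> J n" if "r \<in> A" "a * r \<in> J n" for r n
  proof -
    obtain s h where *: "s \<in> A" "s \<notin> P" "h \<in> A" "s * (a * r) = f ^ n * h"
      using \<open>a * r \<in> J n\<close> unfolding J_def by blast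
    show ?thesis unfolding J_def mem_Collect_eq
      by (intro conjI bexI[of _ "s * a"] bexI[of _ h])
         (use * that A aA Pm[OF *(1) aA] False in \<open>auto simp: mult_ac intro: subring_intros\<close>)
  qed
  \<comment> \<open>\<open>bin m n\<close> says that b ^ m lies in \<open>J n\<close> + aA. By
    \<open>unit_expansion\<close> this ideal is (a, b ^ \<open>\<rho> n\<close>), with \<rho>
    defined below as the least such m. The sequence \<rho> is nondecreasing and bounded by N, so two
    consecutive values agree.\<close>
  define bin where "bin m n \<longleftrightarrow> (\<exists>j\<in>J n. \<exists>r\<in>A. b ^ m = j + a * r)" for m n
  have binN: "bin N n" for n
    unfolding bin_def using nil ideal_zero[OF J] by force
  define \<rho> where "\<rho> n = (LEAST m. bin m n)" for n
  have \<rho>: "bin (\<rho> n) n" for n unfolding \<rho>_def using binN by (rule LeastI)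
  have \<rho>_le: "\<rho> n \<le> m" if "bin m n" for m n unfolding \<rho>_def using that by (rule Least_le)
  have "\<rho> n \<le> \<rho> (Suc n)" for n
    using \<rho>[of "Suc n"] Jdec[of n] by (intro \<rho>_le) (auto simp: bin_def)
  moreover have "\<rho> n \<le> N" for n using \<rho>_le[OF binN] .
  ultimately have "\<exists>n. \<rho> (Suc n) = \<rho> n"
    using strict_mono_imp_increasing[of \<rho> "Suc N"] strict_mono_Suc_iff[of \<rho>]
    by (metis le_neq_implies_less not_less_eq_eq order_trans)
  then obtain n where n: "\<rho> (Suc n) = \<rho> n" by blast
  \<comment> \<open>An element of \<open>J n\<close> outside aA has b-order at least
    \<open>\<rho> (Suc n)\<close>, so a multiple of an element of \<open>J (Suc n)\<close> agrees
    with it modulo a. The difference a h lies in \<open>J n\<close>, and \<open>Ja\<close> puts h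
    there too.\<close>
  have "J n \<subseteq> J (Suc n)"
  proof (rule nakayama[OF loc noeth a_max J J])
    fix z assume z: "z \<in> J n"
    have zA: "z \<in> A" using ideal_subset[OF J z] .
    show "\<exists>j\<in>J (Suc n). \<exists>h\<in>J n. z = j + a * h"
    proof (cases "z \<in> (*) a ` A")
      case True
      then obtain r where "r \<in> A" "z = 0 + a * r" by auto
      then show ?thesis using Ja z ideal_zero[OF J] by (metis add_0)
    next
      case False
      obtain l r u where u: "r \<in> A" "unit_in A u" "z = a * r + b ^ l * u"
        using unit_expansion[OF zA False] .
      have uA: "u \<in> A" "inverse u \<in> A" "u \<noteq> 0" using u(2) by (auto simp: unit_in_def)
      have "b ^ l = inverse u * z + a * (- (inverse u * r))"
        using u(3) uA(3) by (simp add: field_simps)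
      moreover have "inverse u * z \<in> J n" "- (inverse u * r) \<in> A"
        using ideal_mult[OF J uA(2) z] A u uA by (auto intro: subring_intros)
      ultimately have "bin l n" unfolding bin_def by blast
      then have l: "\<rho> n \<le> l" by (rule \<rho>_le)
      obtain j r' where j: "j \<in> J (Suc n)" "r' \<in> A" "b ^ \<rho> n = j + a * r'"
        using \<rho>[of "Suc n"] unfolding n bin_def by blast
      define c where "c = b ^ (l - \<rho> n) * u"
      have cA: "c \<in> A" unfolding c_def using A bA uA by (intro subring_intros)
      have "b ^ l * u = b ^ \<rho> n * c"
        unfolding c_def using l by (simp add: mult.assoc[symmetric] power_add[symmetric])
      then have eq: "z = c * j + a * (r + r' * c)" unfolding u(3) j(3) by (simp add: algebra_simps)
      have cj: "c * j \<in> J (Suc n)" using ideal_mult[OF J cA j(1)] .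
      have "a * (r + r' * c) = z - c * j" using eq by simp
      also have "\<dots> \<in> J n" using ideal_diff[OF A J z] cj Jdec by blast
      finally have "r + r' * c \<in> J n"
        using Ja subring_add[OF A u(1) subring_mult[OF A j(2) cA]] by blast
      then show ?thesis using eq cj by blast
    qed
  qed
  \<comment> \<open>As f ^ n now lies in \<open>J (Suc n)\<close>, cancelling f ^ n gives some s
    outside P that is a multiple of f, although f lies in P.\<close>
  moreover have "f ^ n \<in> J n" unfolding J_def mem_Collect_eq
    by (intro conjI bexI[of _ 1]) (use A fA P1 in \<open>auto intro: subring_intros\<close>)
  ultimately obtain s h where "s \<in> A" "s \<notin> P" "h \<in> A" "s * f ^ n = f ^ Suc n * h"
    unfolding J_def by blast
  then have "s = f * h" using f(2) by simp
  then show ?thesis using \<open>s \<notin> P\<close> ideal_mult_right[OF PI \<open>h \<in> A\<close> f(1)] by simp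
qed

end

section \<open>Dimension two expressed by the pair of parameters\<close>

lemma krull_dim_2_intermediate_prime:
  assumes "krull_dim_eq A 2"
  obtains P f where "prime_ideal P A" "f \<in> P" "f \<noteq> 0" "P \<noteq> max_ideal A"
proof -
  obtain Ps where Ps: "prime_chain A Ps" "length Ps = 3"
    using assms unfolding krull_dim_eq_def by auto
  then obtain P0 P1 P2 where "Ps = [P0, P1, P2]"
    by (auto simp: length_Suc_conv numeral_3_eq_3)
  then have P: "prime_ideal P0 A" "prime_ideal P1 A" "prime_ideal P2 A" "P0 \<subset> P1" "P1 \<subset> P2"
    using Ps(1) by (auto simp: prime_chain_def)
  obtain f where f: "f \<in> P1" "f \<notin> P0" using P(4) by blast
  have "0 \<in> P0" using P(1) by (auto simp: prime_ideal_def is_ideal_def)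
  moreover have "P2 \<subseteq> max_ideal A" using P(3) proper_ideal_le_max[of P2 A] by (simp add: prime_ideal_def)
  ultimately show ?thesis using P f by (intro that[of P1 f]) auto
qed

lemma regular_params_two_gen_local:
  assumes "regular_params A a b"
  shows "two_gen_local A a b"
  using assms gen_ideal_pair[OF local_subring, of A a b]
  by unfold_locales (auto simp: regular_params_def)

lemma regular_params_commute: "regular_params A a b \<longleftrightarrow> regular_params A b a"
  by (auto simp: regular_params_def insert_commute)

text \<open>The working form of dimension two: if b were nilpotent modulo a, the middle prime of a
  chain of three would already be the maximal ideal.\<close>

lemma regular_params_not_nilpotent:
  assumes "regular_params A a b"
  shows "b ^ n \<notin> (*) a ` A"
proof
  assume "b ^ n \<in> (*) a ` A"
  moreover obtain P f where "prime_ideal P A" "f \<in> P" "f \<noteq> 0" "P \<noteq> max_ideal A"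
    using krull_dim_2_intermediate_prime assms unfolding regular_params_def by blast
  ultimately show False
    using two_gen_local.prime_trivial_if_nilpotent[OF regular_params_two_gen_local[OF assms]] by blast
qed

lemma regular_params_nonzero:
  assumes "regular_params A a b"
  shows "a \<noteq> 0" "b \<noteq> 0"
proof -
  have 0: "0 \<in> A" using assms by (auto simp: regular_params_def local_ring_def subring_def)
  show "b \<noteq> 0" using regular_params_not_nilpotent[OF assms, of 1] 0 by (auto simp: image_iff)
  show "a \<noteq> 0" using regular_params_not_nilpotent[of A b a 1] assms 0 regular_params_commute[of A a b]
    by (auto simp: image_iff)
qed

text \<open>By \<open>unit_expansion\<close> two elements outside aA are, modulo a, units times
  powers of b; so is their product, and no power of b lies in aA.\<close>

lemma regular_params_prime:
  assumes reg: "regular_params A a b"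
  shows "prime_ideal ((*) a ` A) A"
proof -
  interpret two_gen_local A a b using regular_params_two_gen_local[OF reg] .
  show ?thesis
    unfolding prime_ideal_def
  proof (intro conjI ballI impI pa one_notin_pa)
    fix z z' assume z: "z \<in> A" "z' \<in> A" "z * z' \<in> (*) a ` A"
    show "z \<in> (*) a ` A \<or> z' \<in> (*) a ` A"
    proof (rule ccontr)
      assume "\<not> ?thesis"
      then obtain m r u m' r' u' where *: "r \<in> A" "unit_in A u" "z = a * r + b ^ m * u"
        "r' \<in> A" "unit_in A u'" "z' = a * r' + b ^ m' * u'"
        using unit_expansion z by metis
      have u: "unit_in A (u * u')" using unit_in_mult[OF A *(2,5)] .
      define w where "w = r * z' + b ^ m * u * r'"
      have wA: "w \<in> A" unfolding w_def using * z A bA by (auto simp: unit_in_def intro!: subring_intros)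
      have "z * z' = a * w + b ^ (m + m') * (u * u')"
        unfolding w_def *(3,6) by (simp add: algebra_simps power_add)
      then have "b ^ (m + m') = inverse (u * u') * (z * z' - a * w)"
        using u by (simp add: unit_in_def field_simps)
      also have "\<dots> \<in> (*) a ` A"
        using u wA by (intro ideal_mult[OF pa] ideal_diff[OF A pa z(3)] imageI) (simp_all add: unit_in_def)
      finally show False using regular_params_not_nilpotent[OF reg] by blast
    qed
  qed
qed

text \<open>The bound on the dimension comes from classifying the primes as zero, principal or
  maximal. A nonzero principal prime cannot properly contain another one, so a chain has at most one
  prime strictly between zero and the maximal ideal.\<close>

lemma regular_paramsI:
  assumes loc: "local_ring A" and noeth: "noetherian A" and gens: "max_ideal A = span2 A a b"
    and prime: "prime_ideal ((*) a ` A) A" and a0: "a \<noteq> 0" and b: "b \<notin> (*) a ` A"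
  shows "regular_params A a b"
proof -
  interpret two_gen_local A a b using assms(1-3) by unfold_locales
  have bpow: "b ^ n \<notin> (*) a ` A" for n using prime_power_mem[OF prime A bA] b by blast
  have zero_prime: "prime_ideal {0} A"
    using subring_zero[OF A] by (auto simp: prime_ideal_def is_ideal_def)
  have classify: "P = max_ideal A \<or> (\<exists>f\<in>P. f \<noteq> 0 \<and> P = (*) f ` A)"
    if P: "prime_ideal P A" and P0: "P \<noteq> {0}" for P
  proof -
    have PI: "is_ideal P A" and P1: "1 \<notin> P"
      and Pm: "\<And>u v. u \<in> A \<Longrightarrow> v \<in> A \<Longrightarrow> u * v \<in> P \<Longrightarrow> u \<in> P \<or> v \<in> P"
      using P by (auto simp: prime_ideal_def)
    have Pmax: "P \<subseteq> max_ideal A" using proper_ideal_le_max[OF PI P1] .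
    show ?thesis
    proof (cases "a \<in> P")
      case True
      have aP: "(*) a ` A \<subseteq> P" using True ideal_mult_right[OF PI] by blast
      show ?thesis
      proof (cases "P \<subseteq> (*) a ` A")
        case False
        then obtain z where z: "z \<in> P" "z \<notin> (*) a ` A" by blast
        obtain m r u where u: "r \<in> A" "unit_in A u" "z = a * r + b ^ m * u"
          using unit_expansion[OF ideal_subset[OF PI z(1)] z(2)] .
        have "b ^ m = inverse u * (z - a * r)" using u by (simp add: unit_in_def field_simps)
        also have "\<dots> \<in> P"
          using u(2) ideal_mult[OF PI _ ideal_diff[OF A PI z(1) ideal_mult_right[OF PI u(1) True]]]
          by (simp only: unit_in_def)
        finally have "b \<in> P" using prime_power_mem[OF P A bA] by blast
        then have "span2 A a b \<subseteq> P" by (rule span2_subset[OF PI True])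
        then show ?thesis using gens Pmax by blast
      qed (use True aP a0 in blast)
    next
      case False
      have aquot: "h \<in> P" if "h \<in> A" "a * h \<in> P" for h using Pm aA that False by blast
      show ?thesis
      proof (cases "P \<subseteq> (*) a ` A")
        case True
        \<comment> \<open>Here P = aP, because a can be cancelled in P, so P vanishes by Nakayama's
          lemma.\<close>
        have "P \<subseteq> {0}"
        proof (rule nakayama[OF loc noeth a_max PI])
          show "is_ideal {0} A" using zero_prime by (simp add: prime_ideal_def)
          fix g assume "g \<in> P"
          then show "\<exists>j\<in>{0}. \<exists>h\<in>P. g = j + a * h" using True aquot by auto
        qed
        then show ?thesis using P0 ideal_zero[OF PI] by blast
      next
        case False
        \<comment> \<open>The generator will be an f in P of least b-order m modulo a. Every g in P
          is then f c + a h, where h lies in P because a does not, and Nakayama's lemma gives P =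
          fA.\<close>
        define ok where "ok m z \<longleftrightarrow> (\<exists>r\<in>A. \<exists>u. unit_in A u \<and> z = a * r + b ^ m * u)" for m z
        have ok: "\<exists>m. ok m z" if "z \<in> P" "z \<notin> (*) a ` A" for z
          using unit_expansion[OF ideal_subset[OF PI that(1)] that(2)] unfolding ok_def by metis
        define m where "m = (LEAST m. \<exists>z\<in>P. ok m z)"
        have "\<exists>m. \<exists>z\<in>P. ok m z" using ok False by blast
        then have "\<exists>z\<in>P. ok m z" unfolding m_def by (rule LeastI_ex)
        then obtain f where f: "f \<in> P" "ok m f" by blast
        have m_le: "m \<le> l" if "z \<in> P" "ok l z" for l z
          unfolding m_def by (rule Least_le) (use that in blast)
        obtain r u where u: "r \<in> A" "unit_in A u" "f = a * r + b ^ m * u"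
          using f(2) unfolding ok_def by blast
        have fA: "f \<in> A" using ideal_subset[OF PI f(1)] .
        have fne: "f \<notin> (*) a ` A"
        proof
          assume "f \<in> (*) a ` A"
          moreover have "b ^ m = inverse u * (f - a * r)" using u by (simp add: unit_in_def field_simps)
          ultimately have "b ^ m \<in> (*) a ` A"
            using u ideal_mult[OF pa] ideal_diff[OF A pa] by (metis imageI unit_in_def)
          then show False using bpow by blast
        qed
        have "P \<subseteq> (*) f ` A"
        proof (rule nakayama[OF loc noeth a_max PI is_ideal_principal[OF A fA]])
          fix g assume g: "g \<in> P"
          show "\<exists>j\<in>(*) f ` A. \<exists>h\<in>P. g = j + a * h"
          proof (cases "g \<in> (*) a ` A")
            case True
            then obtain h where "h \<in> A" "g = a * h" by blast
            then have "h \<in> P" "g = f * 0 + a * h" using aquot g by auto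
            then show ?thesis using subring_zero[OF A] by blast
          next
            case False
            obtain l where "ok l g" using ok g False by blast
            then obtain r' u' where u': "r' \<in> A" "unit_in A u'" "g = a * r' + b ^ l * u'"
              unfolding ok_def by blast
            have ml: "m \<le> l" using m_le g \<open>ok l g\<close> by blast
            define c where "c = b ^ (l - m) * u' * inverse u"
            have cA: "c \<in> A" unfolding c_def
              using A bA u u' by (auto simp: unit_in_def intro: subring_intros)
            have "b ^ l * u' = b ^ m * u * c"
              unfolding c_def using ml u(2)
              by (simp add: unit_in_def field_simps power_add[symmetric])
            then have eq: "g = f * c + a * (r' - r * c)" unfolding u(3) u'(3) by (simp add: algebra_simps)
            have fc: "f * c \<in> P" using ideal_mult_right[OF PI cA f(1)] .
            have "a * (r' - r * c) = g - f * c" using eq by simp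
            then have "r' - r * c \<in> P"
              using ideal_diff[OF A PI g fc] subring_diff[OF A u'(1) subring_mult[OF A u(1) cA]] by (metis aquot)
            then show ?thesis using eq cA by blast
          qed
        qed
        moreover have "(*) f ` A \<subseteq> P" using f(1) ideal_mult_right[OF PI] by blast
        moreover have "f \<noteq> 0" using fne ideal_zero[OF pa] by blast
        ultimately show ?thesis using f(1) by blast
      qed
    qed
  qed
  have "krull_dim_eq A 2"
    unfolding krull_dim_eq_def
  proof (intro conjI exI allI impI)
    have "a \<in> (*) a ` A" using subring_one[OF A] by force
    moreover have "(*) a ` A \<subseteq> max_ideal A"
      using ideal_mult_right[OF max_ideal_ideal[OF loc] _ a_max] by blast
    ultimately show "prime_chain A [{0}, (*) a ` A, max_ideal A]"
      using zero_prime prime max_ideal_prime[OF loc] a0 b b_max ideal_zero[OF pa]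
        ideal_zero[OF max_ideal_ideal[OF loc]]
      by (auto simp: prime_chain_def psubset_eq)
    show "length [{0}, (*) a ` A, max_ideal A] = 2 + 1" by simp
  next
    fix Ps assume Ps: "prime_chain A Ps"
    show "length Ps \<le> 2 + 1"
    proof (rule ccontr)
      assume "\<not> ?thesis"
      then have len: "3 < length Ps" by simp
      have prime: "prime_ideal (Ps ! i) A" if "i \<le> 3" for i
        using Ps len that by (simp add: prime_chain_def)
      have ss: "Ps ! i \<subset> Ps ! j" if "i < j" "j \<le> 3" for i j
        using Ps len that by (auto simp: prime_chain_def sorted_wrt_iff_nth_less)
      have ne0: "Ps ! j \<noteq> {0}" if "0 < j" "j \<le> 3" for j
        using ss[OF that] prime[of 0] by (auto simp: prime_ideal_def is_ideal_def)
      have nem: "Ps ! j \<noteq> max_ideal A" if "j < 3" for j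
        using ss[of j 3] prime[of 3] proper_ideal_le_max[of "Ps ! 3" A] that
        by (auto simp: prime_ideal_def)
      have principal: "\<exists>f\<in>Ps ! j. f \<noteq> 0 \<and> Ps ! j = (*) f ` A" if "0 < j" "j < 3" for j
        using classify[OF prime ne0, of j] nem[OF that(2)] that by simp
      obtain f where f: "f \<in> Ps ! 1" "f \<noteq> 0" "Ps ! 1 = (*) f ` A"
        using principal[of 1] by fastforce
      obtain g where g: "g \<in> Ps ! 2" "g \<noteq> 0" "Ps ! 2 = (*) g ` A"
        using principal[of 2] by fastforce
      have gA: "g \<in> A" using g(1) prime[of 2] by (auto simp: prime_ideal_def is_ideal_def)
      have s12: "Ps ! 1 \<subset> Ps ! 2" using ss[of 1 2] by simp
      \<comment> \<open>With fA strictly inside gA and f = g h, primality of fA leaves h in fA;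
        cancelling f makes g a unit.\<close>
      obtain h where h: "h \<in> A" "f = g * h" using f(1) s12 g(3) by blast
      have P1: "is_ideal (Ps ! 1) A" using prime[of 1] by (simp add: prime_ideal_def)
      have "g \<in> Ps ! 1 \<or> h \<in> Ps ! 1"
        using prime[of 1] f(1) h gA unfolding prime_ideal_def by auto
      then show False
      proof
        assume "g \<in> Ps ! 1"
        then have "Ps ! 2 \<subseteq> Ps ! 1" unfolding g(3) using ideal_mult_right[OF P1] by blast
        then show False using s12 by blast
      next
        assume "h \<in> Ps ! 1"
        then obtain h' where h': "h' \<in> A" "h = f * h'" using f(3) by blast
        have "1 = g * h'" using h(2) h'(2) f(2) by (simp add: field_simps)
        then have "1 \<in> Ps ! 2" using g(3) h'(1) by blast
        then show False using prime[of 2] by (simp add: prime_ideal_def)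
      qed
    qed
  qed
  then show ?thesis
    unfolding regular_params_def using loc noeth aA bA gens gen_ideal_pair[OF A aA bA] by auto
qed

subsection \<open>Hilbert's basis theorem for simple extensions\<close>

text \<open>The set need not be a ring: for \<open>max_ideal A\<close> this expresses that p reduces
  to zero over the residue field.\<close>

definition coeffs_in :: "'a::field set \<Rightarrow> 'a poly \<Rightarrow> bool" where
  "coeffs_in A p \<longleftrightarrow> (\<forall>i. coeff p i \<in> A)"

definition adjoin :: "'a::field set \<Rightarrow> 'a \<Rightarrow> 'a set" where
  "adjoin A t = {poly p t | p. coeffs_in A p}"

lemma coeffs_in_0: "subring A \<Longrightarrow> coeffs_in A 0"
  and coeffs_in_add: "subring A \<Longrightarrow> coeffs_in A p \<Longrightarrow> coeffs_in A r \<Longrightarrow> coeffs_in A (p + r)"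
  and coeffs_in_diff: "subring A \<Longrightarrow> coeffs_in A p \<Longrightarrow> coeffs_in A r \<Longrightarrow> coeffs_in A (p - r)"
  and coeffs_in_smult: "subring A \<Longrightarrow> coeffs_in A p \<Longrightarrow> c \<in> A \<Longrightarrow> coeffs_in A (smult c p)"
  and coeffs_in_monom: "subring A \<Longrightarrow> c \<in> A \<Longrightarrow> coeffs_in A (monom c n)"
  by (auto simp: coeffs_in_def intro: subring_intros)

lemma coeffs_in_mult:
  "subring A \<Longrightarrow> coeffs_in A p \<Longrightarrow> coeffs_in A r \<Longrightarrow> coeffs_in A (p * r)"
  unfolding coeffs_in_def coeff_mult by (blast intro: subring_sum subring_mult)

lemma coeffs_in_pCons: "coeffs_in A (pCons c p) \<longleftrightarrow> c \<in> A \<and> coeffs_in A p"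
  unfolding coeffs_in_def by (force simp: coeff_pCons split: nat.splits)

lemma adjoin_mem: "coeffs_in A p \<Longrightarrow> poly p t \<in> adjoin A t"
  by (auto simp: adjoin_def)

lemma adjoinE:
  assumes "z \<in> adjoin A t"
  obtains p where "coeffs_in A p" "z = poly p t"
  using assms by (auto simp: adjoin_def)

lemma subring_adjoin: 
  assumes "subring A"
  shows "subring (adjoin A t)"
  unfolding subring_def
proof (intro conjI ballI)
  show "0 \<in> adjoin A t" using adjoin_mem[OF coeffs_in_0[OF assms], of t] by simp
  show "1 \<in> adjoin A t" using adjoin_mem[OF coeffs_in_monom[OF assms subring_one[OF assms], of 0], of t]
    by (simp add: poly_monom)
  fix u v assume "u \<in> adjoin A t" "v \<in> adjoin A t"
  then obtain p r where *: "coeffs_in A p" "u = poly p t" "coeffs_in A r" "v = poly r t"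
    by (metis adjoinE)
  show "u + v \<in> adjoin A t" "u - v \<in> adjoin A t" "u * v \<in> adjoin A t"
    using adjoin_mem[OF coeffs_in_add[OF assms *(1,3)], of t]
      adjoin_mem[OF coeffs_in_diff[OF assms *(1,3)], of t]
      adjoin_mem[OF coeffs_in_mult[OF assms *(1,3)], of t]
    by (simp_all add: *(2,4))
qed

lemma adjoin_base:
  assumes "subring A"
  shows "A \<subseteq> adjoin A t"
proof
  fix c assume "c \<in> A"
  then show "c \<in> adjoin A t"
    using adjoin_mem[OF coeffs_in_monom[OF assms, of c 0], of t] by (simp add: poly_monom)
qed

lemma adjoin_gen:
  assumes "subring A"
  shows "t \<in> adjoin A t"
  using adjoin_mem[OF coeffs_in_monom[OF assms subring_one[OF assms], of 1], of t]
  by (simp add: poly_monom)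

lemma adjoin_least:
  assumes R: "subring R" and "A \<subseteq> R" "t \<in> R"
  shows "adjoin A t \<subseteq> R"
proof
  fix z assume "z \<in> adjoin A t"
  then obtain p where "coeffs_in A p" "z = poly p t" by (rule adjoinE)
  moreover have "coeffs_in A p \<Longrightarrow> poly p t \<in> R"
  proof (induction p)
    case 0
    then show ?case using subring_zero[OF R] by simp
  next
    case (pCons c p)
    then show ?case using assms by (auto simp: coeffs_in_pCons intro: subring_intros)
  qed
  ultimately show "z \<in> R" by simp
qed

text \<open>Elements of the extension have no degree of their own, since t may satisfy relations
  over A. So \<open>L K d\<close> collects the d-th coefficients of all polynomials of degree at
  most d whose value at t lies in K. For K inside I, having \<open>L I d\<close> inside
  \<open>L K d\<close> for all d forces K = I by removing top coefficients one after the
  other.\<close>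

theorem hilbert_basis:
  assumes A: "subring A" and noeth: "noetherian A"
  shows "noetherian (adjoin A t)"
proof (rule noetherianI[OF subring_adjoin[OF A]])
  let ?B = "adjoin A t"
  have B: "subring ?B" by (rule subring_adjoin[OF A])
  have AB: "A \<subseteq> ?B" by (rule adjoin_base[OF A])
  have tB: "t \<in> ?B" by (rule adjoin_gen[OF A])
  fix I assume I: "is_ideal I ?B"
  define L where "L K d = {coeff p d | p. coeffs_in A p \<and> (\<forall>i>d. coeff p i = 0) \<and> poly p t \<in> K}" for K d
  have LI: "coeff p d \<in> L K d" if "coeffs_in A p" "\<forall>i>d. coeff p i = 0" "poly p t \<in> K" for p d K
    using that unfolding L_def by blast
  have LE: "\<exists>p. coeffs_in A p \<and> (\<forall>i>d. coeff p i = 0) \<and> poly p t \<in> K \<and> c = coeff p d"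
    if "c \<in> L K d" for c d K
    using that unfolding L_def by blast
  have L_ideal: "is_ideal (L K d) A" if K: "is_ideal K ?B" for K d
    unfolding is_ideal_def
  proof (intro conjI ballI subsetI)
    fix c assume "c \<in> L K d"
    then show "c \<in> A" using LE unfolding coeffs_in_def by blast
  next
    show "0 \<in> L K d"
      using LI[OF coeffs_in_0[OF A], of d K] ideal_zero[OF K] by simp
  next
    fix c c' assume "c \<in> L K d" "c' \<in> L K d"
    then obtain p p' where *: "coeffs_in A p" "\<forall>i>d. coeff p i = 0" "poly p t \<in> K" "c = coeff p d"
      "coeffs_in A p'" "\<forall>i>d. coeff p' i = 0" "poly p' t \<in> K" "c' = coeff p' d"
      using LE by metis
    show "c + c' \<in> L K d"
      using LI[OF coeffs_in_add[OF A *(1,5)], of d K] * ideal_add[OF K] by simp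
  next
    fix r c assume r: "r \<in> A" and "c \<in> L K d"
    then obtain p where *: "coeffs_in A p" "\<forall>i>d. coeff p i = 0" "poly p t \<in> K" "c = coeff p d"
      using LE by metis
    have "r * poly p t \<in> K" using ideal_mult[OF K] r AB *(3) by blast
    then show "r * c \<in> L K d"
      using LI[OF coeffs_in_smult[OF A *(1) r], of d K] * by simp
  qed
  have L_mono: "L K d \<subseteq> L K (Suc d)" if K: "is_ideal K ?B" for K d
  proof
    fix c assume "c \<in> L K d"
    then obtain p where *: "coeffs_in A p" "\<forall>i>d. coeff p i = 0" "poly p t \<in> K" "c = coeff p d"
      using LE by metis
    have "coeffs_in A (pCons 0 p)" using *(1) subring_zero[OF A] by (simp add: coeffs_in_pCons)
    moreover have "\<forall>i>Suc d. coeff (pCons 0 p) i = 0"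
      using *(2) by (simp add: coeff_pCons split: nat.splits)
    moreover have "poly (pCons 0 p) t \<in> K" using ideal_mult[OF K tB *(3)] by simp
    ultimately show "c \<in> L K (Suc d)" using LI[of "pCons 0 p" "Suc d" K] *(4) by simp
  qed
  obtain N where N: "\<And>n. N \<le> n \<Longrightarrow> L I n = L I N"
    using noetherian_chain_stable[OF A noeth, of "L I"] L_ideal[OF I] L_mono[OF I] by metis
  have "\<exists>F. finite F \<and> F \<subseteq> L I d \<and> L I d = gen_ideal A F" for d
    using noeth[unfolded noetherian_def, rule_format, OF L_ideal[OF I, of d]] .
  then obtain F where F: "\<And>d. finite (F d)" "\<And>d. F d \<subseteq> L I d" "\<And>d. L I d = gen_ideal A (F d)"
    by metis
  have "\<forall>d c. \<exists>p. c \<in> L I d \<longrightarrow>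
    coeffs_in A p \<and> (\<forall>i>d. coeff p i = 0) \<and> poly p t \<in> I \<and> c = coeff p d" using LE by blast
  then obtain rep where rep: "\<And>d c. c \<in> L I d \<Longrightarrow> coeffs_in A (rep d c) \<and>
    (\<forall>i>d. coeff (rep d c) i = 0) \<and> poly (rep d c) t \<in> I \<and> c = coeff (rep d c) d"
    by metis
  \<comment> \<open>Degrees up to N suffice, since \<open>L I\<close> is constant from N on.\<close>
  define G where "G = (\<Union>d\<le>N. (\<lambda>c. poly (rep d c) t) ` F d)"
  have finG: "finite G" unfolding G_def using F(1) by blast
  have GI: "G \<subseteq> I" unfolding G_def using rep F(2) by blast
  define K where "K = gen_ideal ?B G"
  have K: "is_ideal K ?B"
    unfolding K_def using GI ideal_subset[OF I] by (intro is_ideal_gen[OF B]) blast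
  have KI: "K \<subseteq> I" unfolding K_def by (rule gen_ideal_least[OF I GI])
  have GK: "G \<subseteq> K" unfolding K_def by (rule gen_ideal_superset)
  have L_low: "L I d \<subseteq> L K d" if "d \<le> N" for d
    unfolding F(3)[of d]
  proof (rule gen_ideal_least[OF L_ideal[OF K]], rule subsetI)
    fix c assume c: "c \<in> F d"
    then have "poly (rep d c) t \<in> K" using GK that unfolding G_def by blast
    then show "c \<in> L K d" using LI[of "rep d c" d K] rep[of c d] F(2)[of d] c by auto
  qed
  have L_sub: "L I d \<subseteq> L K d" for d
  proof (cases "d \<le> N")
    case False
    then have "L I d = L I N" by (intro N) simp
    also have "\<dots> \<subseteq> L K N" by (rule L_low) simp
    also have "\<dots> \<subseteq> L K d" using False by (intro lift_Suc_mono_le[of "L K", OF L_mono[OF K]]) simp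
    finally show ?thesis .
  qed (rule L_low)
  \<comment> \<open>n is a strict bound for the degree, so the induction starts at the zero
    polynomial.\<close>
  have poly_K: "coeffs_in A p \<Longrightarrow> (\<forall>i\<ge>n. coeff p i = 0) \<Longrightarrow> poly p t \<in> I \<Longrightarrow> poly p t \<in> K" for n p
  proof (induction n arbitrary: p)
    case 0
    then have "p = 0" by (simp add: poly_eq_iff)
    then show ?case using ideal_zero[OF K] by simp
  next
    case (Suc n)
    have "coeff p n \<in> L K n"
      using LI[OF Suc.prems(1) _ Suc.prems(3), of n] Suc.prems(2) L_sub Suc_le_eq by blast
    then obtain r where r: "coeffs_in A r" "\<forall>i>n. coeff r i = 0" "poly r t \<in> K" "coeff p n = coeff r n"
      using LE by metis
    have "\<forall>i\<ge>n. coeff (p - r) i = 0"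
      using Suc.prems(2) r(2,4) by (metis Suc_leI coeff_diff diff_self le_neq_implies_less)
    moreover have "poly (p - r) t \<in> I"
      using ideal_diff[OF B I Suc.prems(3)] r(3) KI by auto
    ultimately have "poly (p - r) t \<in> K"
      using Suc.IH coeffs_in_diff[OF A Suc.prems(1) r(1)] by blast
    then show ?case using ideal_add[OF K _ r(3)] by force
  qed
  have "I \<subseteq> K"
  proof
    fix z assume z: "z \<in> I"
    then obtain p where p: "coeffs_in A p" "z = poly p t" using ideal_subset[OF I] adjoinE by metis
    have "\<forall>i\<ge>Suc (degree p). coeff p i = 0" by (simp add: coeff_eq_0)
    then show "z \<in> K" using poly_K p z by blast
  qed
  then show "\<exists>F. finite F \<and> F \<subseteq> I \<and> I \<subseteq> gen_ideal ?B F"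
    using finG GI unfolding K_def by blast
qed

subsection \<open>Localization at the center of a valuation\<close>

locale rational_valuation =
  fixes k :: "'a::field set" and \<nu> :: "'a \<Rightarrow> rat"
  assumes subfield_k: "subfield k" and valuation: "k_valuation k \<nu>"
    and residue: "residue_field_k \<nu> k"
begin

lemma subring_k: "subring k" using subfield_k by (simp add: subfield_def)

lemma \<nu>_mult: "a \<noteq> 0 \<Longrightarrow> b \<noteq> 0 \<Longrightarrow> \<nu> (a * b) = \<nu> a + \<nu> b"
  and \<nu>_add: "a \<noteq> 0 \<Longrightarrow> b \<noteq> 0 \<Longrightarrow> a + b \<noteq> 0 \<Longrightarrow> min (\<nu> a) (\<nu> b) \<le> \<nu> (a + b)"
  and \<nu>_const: "c \<in> k \<Longrightarrow> c \<noteq> 0 \<Longrightarrow> \<nu> c = 0"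
  using valuation by (auto simp: k_valuation_def)

lemma \<nu>_one: "\<nu> 1 = 0"
  using \<nu>_const subring_one[OF subring_k] by simp

lemma \<nu>_uminus: "\<nu> (- a) = \<nu> a"
proof (cases "a = 0")
  case False
  then show ?thesis
    using \<nu>_mult[of "-1" a] \<nu>_const[of "-1"] subring_uminus[OF subring_k subring_one[OF subring_k]]
    by simp
qed simp

lemma \<nu>_inverse: "a \<noteq> 0 \<Longrightarrow> \<nu> (inverse a) = - \<nu> a"
  using \<nu>_mult[of a "inverse a"] \<nu>_one by simp

lemma \<nu>_divide: "a \<noteq> 0 \<Longrightarrow> b \<noteq> 0 \<Longrightarrow> \<nu> (a / b) = \<nu> a - \<nu> b"
  using \<nu>_mult[of a "inverse b"] \<nu>_inverse[of b] by (simp add: divide_inverse)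

lemma \<nu>_power: "a \<noteq> 0 \<Longrightarrow> \<nu> (a ^ n) = of_nat n * \<nu> a"
  by (induction n) (auto simp: \<nu>_one \<nu>_mult algebra_simps)

lemma \<nu>_prod:
  "finite I \<Longrightarrow> (\<And>i. i \<in> I \<Longrightarrow> f i \<noteq> 0) \<Longrightarrow> \<nu> (prod f I) = (\<Sum>i\<in>I. \<nu> (f i))"
  by (induction I rule: finite_induct) (auto simp: \<nu>_one \<nu>_mult)

lemma subring_val_ring: "subring (val_ring \<nu>)"
proof -
  have add: "a + b \<in> val_ring \<nu>" if "a \<in> val_ring \<nu>" "b \<in> val_ring \<nu>" for a b
    using that \<nu>_add[of a b] by (cases "a = 0 \<or> b = 0 \<or> a + b = 0") (auto simp: val_ring_def)
  have "- b \<in> val_ring \<nu>" if "b \<in> val_ring \<nu>" for b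
    using that by (auto simp: val_ring_def \<nu>_uminus)
  then have "a - b \<in> val_ring \<nu>" if "a \<in> val_ring \<nu>" "b \<in> val_ring \<nu>" for a b
    using add[of a "- b"] that by simp
  moreover have "a * b \<in> val_ring \<nu>" if "a \<in> val_ring \<nu>" "b \<in> val_ring \<nu>" for a b
    using that \<nu>_mult[of a b] by (cases "a = 0 \<or> b = 0") (auto simp: val_ring_def)
  ultimately show ?thesis
    using add by (auto simp: subring_def) (auto simp: val_ring_def \<nu>_one)
qed

lemma is_ideal_val_max: "is_ideal (val_max \<nu>) (val_ring \<nu>)"
proof -
  have "a + b \<in> val_max \<nu>" if "a \<in> val_max \<nu>" "b \<in> val_max \<nu>" for a b
    using that \<nu>_add[of a b] by (cases "a = 0 \<or> b = 0 \<or> a + b = 0") (auto simp: val_max_def)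
  moreover have "a * b \<in> val_max \<nu>" if "a \<in> val_ring \<nu>" "b \<in> val_max \<nu>" for a b
    using that \<nu>_mult[of a b] by (cases "a = 0 \<or> b = 0") (auto simp: val_max_def val_ring_def)
  ultimately show ?thesis by (auto simp: is_ideal_def) (auto simp: val_max_def val_ring_def)
qed

lemma val_max_prime:
  assumes "a \<in> val_ring \<nu>" "b \<in> val_ring \<nu>" "a * b \<in> val_max \<nu>"
  shows "a \<in> val_max \<nu> \<or> b \<in> val_max \<nu>"
  using assms \<nu>_mult[of a b] by (cases "a = 0 \<or> b = 0") (auto simp: val_max_def val_ring_def)

lemma val_ring_unit_iff: "z \<in> val_ring \<nu> - val_max \<nu> \<longleftrightarrow> z \<noteq> 0 \<and> \<nu> z = 0"
  by (auto simp: val_ring_def val_max_def)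

lemma const_val_max: "c \<in> k \<Longrightarrow> c \<in> val_max \<nu> \<Longrightarrow> c = 0"
  using \<nu>_const by (force simp: val_max_def)

lemma unit_in_notin_val_max:
  assumes "R \<subseteq> val_ring \<nu>" "unit_in R u"
  shows "u \<notin> val_max \<nu>" "\<nu> u = 0"
proof -
  have "u \<in> val_ring \<nu>" "inverse u \<in> val_ring \<nu>" "u \<noteq> 0" using assms by (auto simp: unit_in_def)
  then have "0 \<le> \<nu> u" "0 \<le> - \<nu> u" "u \<noteq> 0" using \<nu>_inverse[of u] by (auto simp: val_ring_def)
  then show "u \<notin> val_max \<nu>" "\<nu> u = 0" by (auto simp: val_max_def)
qed

lemma dominated_max_ideal:
  assumes "dominated R \<nu>"
  shows "max_ideal R = R \<inter> val_max \<nu>"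
  using assms unit_in_notin_val_max[of R] by (auto simp: dominated_def max_ideal_def)

abbreviation center_localization :: "'a set \<Rightarrow> 'a set" where
  "center_localization B \<equiv> localization B (B \<inter> val_max \<nu>)"

context
  fixes B
  assumes B: "subring B" and B_val: "B \<subseteq> val_ring \<nu>"
begin

lemma center_localization_mem:
  "z \<in> center_localization B \<longleftrightarrow> (\<exists>f\<in>B. \<exists>s\<in>B. s \<notin> val_max \<nu> \<and> z = f / s)"
  unfolding localization_def by blast

lemma denominator:
  assumes "s \<in> B" "s \<notin> val_max \<nu>"
  shows "s \<noteq> 0" "\<nu> s = 0"
  using assms val_ring_unit_iff[of s] B_val by auto

lemma denominator_mult:
  "s \<in> B \<Longrightarrow> s \<notin> val_max \<nu> \<Longrightarrow> s' \<in> B \<Longrightarrow> s' \<notin> val_max \<nu> \<Longrightarrow> s * s' \<in> B - val_max \<nu>"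
  using val_max_prime[of s s'] B_val subring_mult[OF B] by blast

lemma one_notin_val_max: "1 \<notin> val_max \<nu>"
  by (auto simp: val_max_def \<nu>_one)

lemma center_localization_base: "B \<subseteq> center_localization B"
proof
  fix z assume "z \<in> B"
  then show "z \<in> center_localization B"
    unfolding center_localization_mem
    by (intro bexI[of _ z] bexI[of _ 1]) (auto simp: one_notin_val_max subring_one[OF B])
qed

lemma subring_center_localization: "subring (center_localization B)"
  unfolding subring_def
proof (intro conjI ballI)
  show "0 \<in> center_localization B" "1 \<in> center_localization B"
    using center_localization_base subring_zero[OF B] subring_one[OF B] by auto
  fix u v assume "u \<in> center_localization B" "v \<in> center_localization B"
  then obtain f s g r where *: "f \<in> B" "s \<in> B" "s \<notin> val_max \<nu>" "u = f / s"
    "g \<in> B" "r \<in> B" "r \<notin> val_max \<nu>" "v = g / r"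
    unfolding center_localization_mem by blast
  have nz: "s \<noteq> 0" "r \<noteq> 0" using denominator * by auto
  have sr: "s * r \<in> B" "s * r \<notin> val_max \<nu>" using denominator_mult[of s r] * by auto
  have "u + v = (f * r + g * s) / (s * r)" "u - v = (f * r - g * s) / (s * r)" "u * v = (f * g) / (s * r)"
    unfolding *(4,8) using nz by (auto simp: field_simps)
  moreover have "f * r + g * s \<in> B" "f * r - g * s \<in> B" "f * g \<in> B"
    using * B by (auto intro: subring_intros)
  ultimately show "u + v \<in> center_localization B" "u - v \<in> center_localization B"
    "u * v \<in> center_localization B"
    unfolding center_localization_mem using sr by blast+
qed

lemma center_localization_val: "center_localization B \<subseteq> val_ring \<nu>"
proof
  fix z assume "z \<in> center_localization B"
  then obtain f s where *: "f \<in> B" "s \<in> B" "s \<notin> val_max \<nu>" "z = f / s"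
    unfolding center_localization_mem by blast
  then show "z \<in> val_ring \<nu>"
    using denominator[of s] \<nu>_divide[of f s] B_val by (cases "f = 0") (auto simp: val_ring_def)
qed

text \<open>A fraction of value 0 has a numerator of value 0, and such a numerator is itself an
  admissible denominator.\<close>

lemma center_localization_max: "max_ideal (center_localization B) = center_localization B \<inter> val_max \<nu>"
proof -
  have "unit_in (center_localization B) z" if zC: "z \<in> center_localization B" and zm: "z \<notin> val_max \<nu>" for z
  proof -
    obtain f s where *: "f \<in> B" "s \<in> B" "s \<notin> val_max \<nu>" "z = f / s"
      using zC unfolding center_localization_mem by blast
    have z: "z \<noteq> 0" "\<nu> z = 0" using zC zm center_localization_val val_ring_unit_iff[of z] by auto
    then have "f \<noteq> 0" using *(4) by auto
    then have "\<nu> f = 0"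
      using z(2) denominator[OF *(2,3)] \<nu>_divide[of f s] unfolding *(4) by simp
    with \<open>f \<noteq> 0\<close> have "f \<notin> val_max \<nu>" by (simp add: val_max_def)
    moreover have "inverse z = s / f" using * by simp
    ultimately show ?thesis using * z zC unfolding unit_in_def center_localization_mem by blast
  qed
  then show ?thesis
    using unit_in_notin_val_max[OF center_localization_val] unfolding max_ideal_def by blast
qed

lemma local_center_localization: "local_ring (center_localization B)"
  unfolding local_ring_def
proof
  show "is_ideal (max_ideal (center_localization B)) (center_localization B)"
    unfolding center_localization_max is_ideal_def
    using subring_center_localization center_localization_val ideal_zero[OF is_ideal_val_max]
      ideal_add[OF is_ideal_val_max] ideal_mult[OF is_ideal_val_max]
    by (auto intro: subring_intros)
qed (rule subring_center_localization)

lemma dominated_center_localization: "dominated (center_localization B) \<nu>"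
  unfolding dominated_def using center_localization_val center_localization_max by blast

text \<open>An ideal of the localization is generated by its contraction to B.\<close>

lemma noetherian_center_localization:
  assumes "noetherian B"
  shows "noetherian (center_localization B)"
proof (rule noetherianI[OF subring_center_localization])
  let ?C = "center_localization B"
  have contract: "is_ideal (K \<inter> B) B" if K: "is_ideal K ?C" for K
    unfolding is_ideal_def
    using B center_localization_base ideal_zero[OF K] ideal_add[OF K] ideal_mult[OF K]
    by (auto intro: subring_intros)
  fix I assume I: "is_ideal I ?C"
  obtain F where F: "finite F" "F \<subseteq> I \<inter> B" "I \<inter> B = gen_ideal B F"
    using assms[unfolded noetherian_def, rule_format, OF contract[OF I]] by blast
  let ?K = "gen_ideal ?C F"
  have K: "is_ideal ?K ?C"
    using F(2) center_localization_base by (intro is_ideal_gen subring_center_localization) blast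
  have IK: "I \<inter> B \<subseteq> ?K"
    unfolding F(3) using gen_ideal_least[OF contract[OF K], of F] gen_ideal_superset[of F ?C] F(2) by blast
  have "I \<subseteq> ?K"
  proof
    fix z assume z: "z \<in> I"
    then obtain f s where *: "f \<in> B" "s \<in> B" "s \<notin> val_max \<nu>" "z = f / s"
      using ideal_subset[OF I] unfolding center_localization_mem by blast
    have s: "s \<noteq> 0" using denominator * by blast
    have "s * z \<in> I" using ideal_mult[OF I _ z] *(2) center_localization_base by blast
    moreover have "s * z = f" using *(4) s by simp
    ultimately have "f \<in> ?K" using IK *(1) by blast
    moreover have "1 / s \<in> ?C" unfolding center_localization_mem using * subring_one[OF B] by blast
    ultimately show "z \<in> ?K" using ideal_mult[OF K, of "1 / s" f] *(4) by simp
  qed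
  then show "\<exists>F. finite F \<and> F \<subseteq> I \<and> I \<subseteq> gen_ideal ?C F" using F by blast
qed

end

end

subsection \<open>Quadratic transforms\<close>

context
  fixes A :: "'a::field set" and a b
  assumes reg: "regular_params A a b"
begin

interpretation two_gen_local A a b
  by (rule regular_params_two_gen_local[OF reg])

lemma a_nonzero: "a \<noteq> 0" using regular_params_nonzero[OF reg] by blast

lemma pa_prime:
  "u \<in> A \<Longrightarrow> v \<in> A \<Longrightarrow> u * v \<in> (*) a ` A \<Longrightarrow> u \<in> (*) a ` A \<or> v \<in> (*) a ` A"
  using regular_params_prime[OF reg] by (auto simp: prime_ideal_def)

lemma max_ideal_ring: "is_ideal (max_ideal A) A"
  by (rule max_ideal_ideal[OF loc])

text \<open>As the maximal ideal is (a, b), the single element b / a generates the chart, which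
  brings it within reach of \<open>hilbert_basis\<close>.\<close>

lemma chart_subring:
  "gen_subring (A \<union> {z / a | z. z \<in> max_ideal A}) = adjoin A (b / a)"
proof
  let ?X = "A \<union> {z / a | z. z \<in> max_ideal A}"
  have B: "subring (adjoin A (b / a))" by (rule subring_adjoin[OF A])
  have "z / a \<in> adjoin A (b / a)" if z: "z \<in> max_ideal A" for z
  proof -
    obtain r s where rs: "r \<in> A" "s \<in> A" "z = a * r + b * s" using z unfolding gens span2_def by blast
    have "z / a = r + (b / a) * s" unfolding rs(3) using a_nonzero by (simp add: field_simps)
    also have "\<dots> \<in> adjoin A (b / a)"
      using rs(1,2) adjoin_base[OF A] by (intro subring_add[OF B] subring_mult[OF B] adjoin_gen[OF A]) blast+
    finally show ?thesis .
  qed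
  then have "?X \<subseteq> adjoin A (b / a)" using adjoin_base[OF A] by blast
  then show "gen_subring ?X \<subseteq> adjoin A (b / a)" using B unfolding gen_subring_def by blast
  show "adjoin A (b / a) \<subseteq> gen_subring ?X"
    unfolding gen_subring_def
  proof (rule Inter_greatest)
    fix R assume "R \<in> {R. subring R \<and> ?X \<subseteq> R}"
    then have "subring R" "A \<subseteq> R" "b / a \<in> R" using b_max by blast+
    then show "adjoin A (b / a) \<subseteq> R" by (rule adjoin_least)
  qed
qed

text \<open>The factor a ^ n turns the value into a form of degree n in a and b.\<close>

lemma homogenize:
  "coeffs_in A p \<Longrightarrow> \<forall>i>n. coeff p i = 0 \<Longrightarrow> a ^ n * poly p (b / a) \<in> A"
proof (induction n arbitrary: p)
  case 0
  then have "p = [:coeff p 0:]" by (auto simp: poly_eq_iff coeff_pCons split: nat.splits)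
  then have "poly p (b / a) = coeff p 0" by (metis poly_0 add.right_neutral mult_zero_right poly_pCons)
  then show ?case using 0 by (simp add: coeffs_in_def)
next
  case (Suc n)
  obtain c r where p: "p = pCons c r" by (cases p)
  have "\<forall>i>n. coeff r i = 0" using Suc.prems(2) unfolding p by (metis Suc_less_eq coeff_pCons_Suc)
  then have "a ^ n * poly r (b / a) \<in> A" "c \<in> A"
    using Suc.IH Suc.prems(1) by (auto simp: p coeffs_in_pCons)
  then have "a ^ Suc n * c + b * (a ^ n * poly r (b / a)) \<in> A"
    using subring_add[OF A subring_mult[OF A subring_power[OF A aA]] subring_mult[OF A bA]] by blast
  moreover have "a ^ Suc n * poly p (b / a) = a ^ Suc n * c + b * (a ^ n * poly r (b / a))"
    unfolding p using a_nonzero by (simp add: field_simps)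
  ultimately show ?case by simp
qed

text \<open>The relations of \<open>b / a\<close> over \<open>A\<close> have coefficients in the maximal ideal because \<open>a, b\<close>
  is a regular sequence; hence the special fibre of the chart is an affine line.\<close>
lemma relation_coeffs:
  "coeffs_in A p \<Longrightarrow> \<forall>i>n. coeff p i = 0 \<Longrightarrow> poly p (b / a) = 0 \<Longrightarrow> coeffs_in (max_ideal A) p"
proof (induction n arbitrary: p)
  case 0
  then have "p = [:coeff p 0:]" by (auto simp: poly_eq_iff coeff_pCons split: nat.splits)
  moreover from this have "coeff p 0 = 0"
    using 0(3) by (metis poly_0 add.right_neutral mult_zero_right poly_pCons)
  ultimately have "p = 0" by simp
  then show ?case using ideal_zero[OF max_ideal_ring] by (simp add: coeffs_in_def)
next
  case (Suc n)
  define c where "c = coeff p (Suc n)"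
  define r where "r = p - monom c (Suc n)"
  have cA: "c \<in> A" using Suc.prems(1) by (simp add: c_def coeffs_in_def)
  have r: "coeffs_in A r" unfolding r_def
    using Suc.prems(1) cA A by (intro coeffs_in_diff coeffs_in_monom)
  have "coeff r i = 0" if "i > n" for i
    using that Suc.prems(2) by (cases "i = Suc n") (auto simp: r_def c_def coeff_monom)
  then have r0: "\<forall>i>n. coeff r i = 0" by blast
  have poly_r: "poly r (b / a) = - c * (b / a) ^ Suc n"
    using Suc.prems(3) by (simp add: r_def poly_monom)
  \<comment> \<open>Multiplied by a ^ Suc n, the relation makes the top term a multiple of a; no
    power of b lies in the prime aA, so c does.\<close>
  have "b ^ Suc n * c = a * - (a ^ n * poly r (b / a))"
    unfolding poly_r using a_nonzero by (simp add: field_simps)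
  then have "b ^ Suc n * c \<in> (*) a ` A"
    using subring_uminus[OF A homogenize[OF r r0]] by blast
  then have "c \<in> (*) a ` A"
    using pa_prime[OF subring_power[OF A bA] cA] regular_params_not_nilpotent[OF reg] by blast
  then obtain d where d: "d \<in> A" "c = a * d" by blast
  \<comment> \<open>With c = a d, the top term c (b / a) ^ Suc n equals b d (b / a) ^ n, so the
    relation can be rewritten with degree at most n.\<close>
  define p' where "p' = r + monom (b * d) n"
  have "coeffs_in A p'" unfolding p'_def
    using r A bA d(1) by (intro coeffs_in_add coeffs_in_monom subring_mult)
  moreover have "\<forall>i>n. coeff p' i = 0" using r0 by (simp add: p'_def coeff_monom)
  moreover have "poly p' (b / a) = 0"
    using a_nonzero by (simp add: p'_def poly_r poly_monom d(2))
  ultimately have p': "coeffs_in (max_ideal A) p'" by (rule Suc.IH)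
  have cm: "c \<in> max_ideal A" "b * d \<in> max_ideal A"
    unfolding d(2) using ideal_mult_right[OF max_ideal_ring d(1)] a_max b_max by blast+
  have "coeff p i = coeff p' i - (if n = i then b * d else 0) + (if Suc n = i then c else 0)" for i
    by (simp add: p'_def r_def coeff_monom)
  then show ?case
    using p' cm ideal_zero[OF max_ideal_ring] unfolding coeffs_in_def
    by (auto intro!: ideal_add[OF max_ideal_ring] ideal_diff[OF A max_ideal_ring])
qed

text \<open>Let B be the chart. Since b is a times b / a, the maximal ideal of A generates aB in B,
  and \<open>relation_coeffs\<close> shows that reducing coefficients does not depend on the
  representing polynomial. So B / aB is the polynomial ring over the residue field.\<close>

lemma special_fibre:
  assumes "coeffs_in A p"
  shows "poly p (b / a) \<in> (*) a ` adjoin A (b / a) \<longleftrightarrow> coeffs_in (max_ideal A) p"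
proof
  let ?B = "adjoin A (b / a)"
  assume "poly p (b / a) \<in> (*) a ` ?B"
  then obtain r where r: "coeffs_in A r" "poly p (b / a) = a * poly r (b / a)"
    by (auto elim: adjoinE)
  define g where "g = p - smult a r"
  have "coeffs_in A g" unfolding g_def using assms r(1) A aA by (intro coeffs_in_diff coeffs_in_smult)
  moreover have "\<forall>i>degree g. coeff g i = 0" by (simp add: coeff_eq_0)
  moreover have "poly g (b / a) = 0" using r(2) by (simp add: g_def)
  ultimately have g: "coeffs_in (max_ideal A) g" by (rule relation_coeffs)
  have "coeff p i = coeff g i + a * coeff r i" for i by (simp add: g_def)
  then show "coeffs_in (max_ideal A) p"
    using g r(1) unfolding coeffs_in_def
    by (auto intro!: ideal_add[OF max_ideal_ring] ideal_mult_right[OF max_ideal_ring] a_max)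
next
  let ?B = "adjoin A (b / a)"
  have B: "subring ?B" by (rule subring_adjoin[OF A])
  have aB: "is_ideal ((*) a ` ?B) ?B"
    using adjoin_base[OF A] aA by (intro is_ideal_principal[OF B]) blast
  have c: "c \<in> (*) a ` ?B" if c_max: "c \<in> max_ideal A" for c
  proof -
    obtain r s where rs: "r \<in> A" "s \<in> A" "c = a * r + b * s" using c_max unfolding gens span2_def by blast
    have "c = a * (r + (b / a) * s)" unfolding rs(3) using a_nonzero by (simp add: field_simps)
    moreover have "r + (b / a) * s \<in> ?B"
      using rs(1,2) adjoin_base[OF A] by (intro subring_add[OF B] subring_mult[OF B] adjoin_gen[OF A]) blast+
    ultimately show ?thesis by blast
  qed
  show "coeffs_in (max_ideal A) p \<Longrightarrow> poly p (b / a) \<in> (*) a ` ?B"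
  proof (induction p)
    case 0
    then show ?case using ideal_zero[OF aB] by simp
  next
    case (pCons e p)
    then have "e \<in> (*) a ` ?B" "poly p (b / a) \<in> (*) a ` ?B" using c by (auto simp: coeffs_in_pCons)
    then show ?case using ideal_add[OF aB] ideal_mult[OF aB adjoin_gen[OF A]] by simp
  qed
qed

text \<open>As in Gauss's lemma: if i and j are the lowest indices of coefficients outside the
  maximal ideal, the coefficient of the product at i + j is, modulo that ideal, the product of these
  two.\<close>

lemma exceptional_divisor_prime: "prime_ideal ((*) a ` adjoin A (b / a)) (adjoin A (b / a))"
  unfolding prime_ideal_def
proof (intro conjI ballI impI)
  let ?B = "adjoin A (b / a)"
  have B: "subring ?B" by (rule subring_adjoin[OF A])
  show "is_ideal ((*) a ` ?B) ?B"
    using adjoin_base[OF A] aA by (intro is_ideal_principal[OF B]) blast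
  have one: "coeffs_in A 1" using coeffs_in_monom[OF A subring_one[OF A], of 0] by (simp add: one_pCons monom_0)
  have "coeff (1 :: 'a poly) 0 \<notin> max_ideal A" by (simp add: one_notin_max_ideal)
  then show "1 \<notin> (*) a ` ?B" using special_fibre[OF one] unfolding coeffs_in_def by auto
  fix f g assume "f \<in> ?B" "g \<in> ?B" and fg: "f * g \<in> (*) a ` ?B"
  then obtain p r where pr: "coeffs_in A p" "f = poly p (b / a)" "coeffs_in A r" "g = poly r (b / a)"
    by (metis adjoinE)
  show "f \<in> (*) a ` ?B \<or> g \<in> (*) a ` ?B"
  proof (rule ccontr)
    assume "\<not> ?thesis"
    then have ex: "\<exists>i. coeff p i \<notin> max_ideal A" "\<exists>i. coeff r i \<notin> max_ideal A"
      using special_fibre pr by (auto simp: coeffs_in_def)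
    define i where "i = (LEAST i. coeff p i \<notin> max_ideal A)"
    define j where "j = (LEAST j. coeff r j \<notin> max_ideal A)"
    have i: "coeff p i \<notin> max_ideal A" "\<And>l. l < i \<Longrightarrow> coeff p l \<in> max_ideal A"
      unfolding i_def using LeastI_ex[OF ex(1)] not_less_Least by blast+
    have j: "coeff r j \<notin> max_ideal A" "\<And>l. l < j \<Longrightarrow> coeff r l \<in> max_ideal A"
      unfolding j_def using LeastI_ex[OF ex(2)] not_less_Least by blast+
    have pA: "coeff p l \<in> A" and rA: "coeff r l \<in> A" for l using pr by (auto simp: coeffs_in_def)
    have "coeffs_in (max_ideal A) (p * r)"
      using special_fibre[OF coeffs_in_mult[OF A pr(1,3)]] fg pr(2,4) by simp
    then have pr_max: "coeff (p * r) (i + j) \<in> max_ideal A" by (simp add: coeffs_in_def)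
    have pr_eq: "coeff (p * r) (i + j) = coeff p i * coeff r j
        + (\<Sum>l\<in>{..i + j} - {i}. coeff p l * coeff r (i + j - l))"
      unfolding coeff_mult by (subst sum.remove[of _ i]) auto
    have "(\<Sum>l\<in>{..i + j} - {i}. coeff p l * coeff r (i + j - l)) \<in> max_ideal A"
    proof (rule ideal_sum[OF max_ideal_ring])
      fix l assume l: "l \<in> {..i + j} - {i}"
      show "coeff p l * coeff r (i + j - l) \<in> max_ideal A"
      proof (cases "l < i")
        case True
        then show ?thesis using i(2) rA ideal_mult_right[OF max_ideal_ring] by blast
      next
        case False
        then have "i + j - l < j" using l by auto
        then show ?thesis using j(2) pA ideal_mult[OF max_ideal_ring] by blast
      qed
    qed
    from ideal_diff[OF A max_ideal_ring pr_max this]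
    have "coeff p i * coeff r j \<in> max_ideal A" unfolding pr_eq by simp
    then show False
      using max_ideal_prime[OF loc] pA rA i(1) j(1) unfolding prime_ideal_def by blast
  qed
qed

text \<open>A monic polynomial does not reduce to zero over the residue field.\<close>

lemma translate_notin_exceptional:
  assumes "c \<in> A"
  shows "b / a - c \<notin> (*) a ` adjoin A (b / a)"
proof -
  have "coeffs_in A [:- c, 1:]"
    using assms A by (auto simp: coeffs_in_pCons coeffs_in_0 intro: subring_intros)
  moreover have "coeff [:- c, 1:] 1 \<notin> max_ideal A" by (simp add: one_notin_max_ideal)
  then have "\<not> coeffs_in (max_ideal A) [:- c, 1:]" unfolding coeffs_in_def by blast
  ultimately show ?thesis using special_fibre[of "[:- c, 1:]"] by simp
qed

text \<open>Division of a representing polynomial by the monic X - c, with remainder in A.\<close>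

lemma adjoin_translate:
  assumes "c \<in> A" "z \<in> adjoin A (b / a)"
  obtains e s where "e \<in> A" "s \<in> adjoin A (b / a)" "z = e + (b / a - c) * s"
proof -
  let ?B = "adjoin A (b / a)" let ?t = "b / a"
  have B: "subring ?B" by (rule subring_adjoin[OF A])
  have AB: "A \<subseteq> ?B" by (rule adjoin_base[OF A])
  have tB: "?t \<in> ?B" by (rule adjoin_gen[OF A])
  obtain p where p: "coeffs_in A p" "z = poly p ?t" using assms(2) by (rule adjoinE)
  have "coeffs_in A p \<Longrightarrow> \<exists>e\<in>A. \<exists>s\<in>?B. poly p ?t = e + (?t - c) * s"
  proof (induction p)
    case 0
    have "poly 0 ?t = 0 + (?t - c) * 0" by simp
    then show ?case using subring_zero[OF A] subring_zero[OF B] by blast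
  next
    case (pCons c0 p)
    then obtain e s where es: "e \<in> A" "s \<in> ?B" "poly p ?t = e + (?t - c) * s" "c0 \<in> A"
      by (auto simp: coeffs_in_pCons)
    have "poly (pCons c0 p) ?t = (c0 + c * e) + (?t - c) * (e + ?t * s)"
      unfolding poly_pCons es(3) by (simp only: algebra_simps)
    moreover have "c0 + c * e \<in> A" using es assms(1) A by (intro subring_add subring_mult)
    moreover have "e + ?t * s \<in> ?B"
      by (rule subring_add[OF B subsetD[OF AB es(1)] subring_mult[OF B tB es(2)]])
    ultimately show ?case by blast
  qed
  then show ?thesis using p that by blast
qed

end

section \<open>Blow-up at the centre of the valuation\<close>

context rational_valuation
begin

lemma residue_field_local:
  assumes "k \<subseteq> A" "subring A" "dominated A \<nu>" "z \<in> A"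
  obtains c where "c \<in> k" "z - c \<in> max_ideal A"
proof -
  obtain c where c: "c \<in> k" "z - c \<in> val_max \<nu>"
    using residue assms(3,4) unfolding residue_field_k_def residue_is_def dominated_def by blast
  moreover have "z - c \<in> A" using assms c by (intro subring_diff) auto
  ultimately show ?thesis using dominated_max_ideal[OF assms(3)] that by blast
qed

text \<open>The value of b / a is nonnegative, so the centre lies on the chart A[b / a], at the
  point b / a = c of the exceptional line. There a and b / a - c generate the maximal ideal, and
  \<open>regular_paramsI\<close> applies because primality of the ideal of a survives
  localization.\<close>

theorem blowup:
  assumes reg: "regular_params A a b" and kA: "k \<subseteq> A" and dom: "dominated A \<nu>" and le: "\<nu> a \<le> \<nu> b"
  obtains A' c where "quadratic_transform \<nu> A A'" "regular_params A' a (b / a - c)" "k \<subseteq> A'"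
    "dominated A' \<nu>" "A \<subseteq> A'" "b / a \<in> A'" "c \<in> k" "b / a - c \<in> val_max \<nu>"
proof -
  interpret two_gen_local A a b by (rule regular_params_two_gen_local[OF reg])
  define t where "t = b / a"
  define B where "B = adjoin A t"
  have nz: "a \<noteq> 0" "b \<noteq> 0" using regular_params_nonzero[OF reg] by auto
  have a_val: "a \<in> val_max \<nu>" using a_max dom by (auto simp: dominated_def)
  have t_val: "t \<in> val_ring \<nu>" using le nz \<nu>_divide[of b a] by (simp add: t_def val_ring_def)
  have B: "subring B" unfolding B_def by (rule subring_adjoin[OF A])
  have AB: "A \<subseteq> B" unfolding B_def by (rule adjoin_base[OF A])
  have tB: "t \<in> B" unfolding B_def by (rule adjoin_gen[OF A])
  have B_val: "B \<subseteq> val_ring \<nu>"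
    unfolding B_def using subring_val_ring dom t_val by (intro adjoin_least) (auto simp: dominated_def)
  obtain c where c: "c \<in> k" "t - c \<in> val_max \<nu>"
    using residue t_val unfolding residue_field_k_def residue_is_def by blast
  define C where "C = center_localization B"
  note C_facts = subring_center_localization[OF B B_val] center_localization_max[OF B B_val]
    local_center_localization[OF B B_val] dominated_center_localization[OF B B_val] center_localization_base[OF B B_val]
  have C: "subring C" and C_max: "max_ideal C = C \<inter> val_max \<nu>"
    and C_loc: "local_ring C" and C_dom: "dominated C \<nu>" and BC: "B \<subseteq> C"
    using C_facts unfolding C_def by auto
  have C_mem: "z \<in> C \<longleftrightarrow> (\<exists>f\<in>B. \<exists>s\<in>B. s \<notin> val_max \<nu> \<and> z = f / s)" for z
    unfolding C_def localization_def by blast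
  have s_nz: "s \<noteq> 0" if "s \<notin> val_max \<nu>" for s using that by (auto simp: val_max_def)
  have C_noeth: "noetherian C"
    unfolding C_def B_def using hilbert_basis[OF A noeth, of t] noetherian_center_localization B B_val
    unfolding B_def by blast
  have aB: "a \<in> B" and tcB: "t - c \<in> B" and cA: "c \<in> A"
    using aA AB tB c(1) kA B by (auto intro!: subring_diff)
  have aC: "a \<in> C" and tcC: "t - c \<in> C" using aB tcB BC by auto
  have aB_val: "(*) a ` B \<subseteq> val_max \<nu>"
    using ideal_mult_right[OF is_ideal_val_max _ a_val] B_val by blast
  \<comment> \<open>After division by t - c the remainder e lies in A and has positive value (or is
    0), so it lies in (a, b), and b = a t turns it into a multiple of a.\<close>
  have center: "z \<in> span2 B a (t - c)" if z: "z \<in> B" "z \<in> val_max \<nu>" for z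
  proof -
    obtain e s where es: "e \<in> A" "s \<in> B" "z = e + (t - c) * s"
      using adjoin_translate[OF reg cA] z(1) unfolding B_def t_def by metis
    have "(t - c) * s \<in> val_max \<nu>"
      using ideal_mult_right[OF is_ideal_val_max _ c(2)] es(2) B_val by blast
    then have "z - (t - c) * s \<in> val_max \<nu>"
      using ideal_diff[OF subring_val_ring is_ideal_val_max z(2)] by blast
    then have "e \<in> max_ideal A" using es(1,3) dominated_max_ideal[OF dom] by simp
    then obtain r s' where rs: "r \<in> A" "s' \<in> A" "e = a * r + b * s'"
      unfolding gens span2_def by blast
    have "z = a * (r + t * s') + (t - c) * s"
      unfolding es(3) rs(3) t_def using nz by (simp add: field_simps)
    moreover have "r + t * s' \<in> B" using rs AB tB B by (auto intro!: subring_add subring_mult)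
    ultimately show ?thesis unfolding span2_def using es(2) by blast
  qed
  have C_gens: "max_ideal C = span2 C a (t - c)"
  proof
    show "span2 C a (t - c) \<subseteq> max_ideal C"
      using aC tcC a_val c(2) by (intro span2_subset[OF max_ideal_ideal[OF C_loc]]) (auto simp: C_max)
    show "max_ideal C \<subseteq> span2 C a (t - c)"
    proof
      fix z assume "z \<in> max_ideal C"
      then have z: "z \<in> C" "z \<in> val_max \<nu>" using C_max by auto
      obtain f s where fs: "f \<in> B" "s \<in> B" "s \<notin> val_max \<nu>" "z = f / s" using z(1) C_mem by blast
      have s: "s \<noteq> 0" using s_nz fs(3) .
      have "f = z * s" using fs(4) s by simp
      then have "f \<in> val_max \<nu>"
        using ideal_mult_right[OF is_ideal_val_max _ z(2)] fs(2) B_val by blast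
      then obtain r s' where rs: "r \<in> B" "s' \<in> B" "f = a * r + (t - c) * s'"
        using center fs(1) unfolding span2_def by blast
      have "z = a * (r / s) + (t - c) * (s' / s)"
        unfolding fs(4) rs(3) by (simp add: add_divide_distrib)
      moreover have "r / s \<in> C" "s' / s \<in> C" using C_mem fs(2,3) rs(1,2) by blast+
      ultimately show "z \<in> span2 C a (t - c)" unfolding span2_def by blast
    qed
  qed
  have B_prime: "u \<in> (*) a ` B \<or> v \<in> (*) a ` B" if "u \<in> B" "v \<in> B" "u * v \<in> (*) a ` B" for u v
    using exceptional_divisor_prime[OF reg] that unfolding prime_ideal_def B_def t_def by blast
  \<comment> \<open>aC meets B only in aB: the denominators have value 0, so none lies in the prime
    aB.\<close>
  have contract: "f \<in> (*) a ` B" if f: "f \<in> B" "f \<in> (*) a ` C" for f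
  proof -
    obtain g where g: "g \<in> C" "f = a * g" using f(2) by blast
    obtain h s where hs: "h \<in> B" "s \<in> B" "s \<notin> val_max \<nu>" "g = h / s" using g(1) C_mem by blast
    have "f * s = a * h" using g(2) hs(4) s_nz[OF hs(3)] by simp
    then have "f * s \<in> (*) a ` B" using hs(1) by blast
    then show ?thesis using B_prime f(1) hs(2,3) aB_val by blast
  qed
  have C_prime: "prime_ideal ((*) a ` C) C"
    unfolding prime_ideal_def
  proof (intro conjI ballI impI)
    show pC: "is_ideal ((*) a ` C) C" by (rule is_ideal_principal[OF C aC])
    show "1 \<notin> (*) a ` C"
      using contract[OF subring_one[OF B]] exceptional_divisor_prime[OF reg]
      unfolding prime_ideal_def B_def t_def by blast
    fix u v assume uv: "u \<in> C" "v \<in> C" "u * v \<in> (*) a ` C"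
    obtain f s where fs: "f \<in> B" "s \<in> B" "s \<notin> val_max \<nu>" "u = f / s" using uv(1) C_mem by blast
    obtain g r where gr: "g \<in> B" "r \<in> B" "r \<notin> val_max \<nu>" "v = g / r" using uv(2) C_mem by blast
    have nz': "s \<noteq> 0" "r \<noteq> 0" using s_nz fs gr by auto
    have "s * r \<in> C" using BC fs(2) gr(2) subring_mult[OF B] by blast
    then have "(s * r) * (u * v) \<in> (*) a ` C" using ideal_mult[OF pC _ uv(3)] by blast
    moreover have "(s * r) * (u * v) = f * g" unfolding fs(4) gr(4) using nz' by simp
    ultimately have "f * g \<in> (*) a ` B" using contract subring_mult[OF B fs(1) gr(1)] by simp
    then have "f \<in> (*) a ` B \<or> g \<in> (*) a ` B" using B_prime fs(1) gr(1) by blast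
    moreover have "f / s \<in> (*) a ` C" if "f \<in> (*) a ` B" "s \<in> B" "s \<notin> val_max \<nu>" for f s
    proof -
      obtain h where "h \<in> B" "f = a * h" using \<open>f \<in> (*) a ` B\<close> by blast
      then have "f / s = a * (h / s)" "h / s \<in> C" using C_mem that by auto
      then show ?thesis by blast
    qed
    ultimately show "u \<in> (*) a ` C \<or> v \<in> (*) a ` C"
      unfolding fs(4) gr(4) using fs(2,3) gr(2,3) by blast
  qed
  have "t - c \<notin> (*) a ` C"
    using contract[OF tcB] translate_notin_exceptional[OF reg cA] unfolding B_def t_def by blast
  then have C_reg: "regular_params C a (t - c)"
    using C_loc C_noeth C_gens C_prime nz(1) by (intro regular_paramsI)
  have "C = localization (gen_subring (A \<union> {z / a | z. z \<in> max_ideal A}))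
      (gen_subring (A \<union> {z / a | z. z \<in> max_ideal A}) \<inter> val_max \<nu>)"
    unfolding chart_subring[OF reg] C_def B_def t_def by (rule refl)
  then have "quadratic_transform \<nu> A C"
    unfolding quadratic_transform_def using reg C_dom by blast
  then show ?thesis
    using that[of C c] C_reg C_dom AB BC tB kA c unfolding t_def by blast
qed

end

subsection \<open>The Euclidean algorithm\<close>

declare eps.simps [simp del]

text \<open>For p < q the first quotient is 0 and that step merely exchanges the two
  numbers.\<close>

lemma eps_commute: "eps p q = eps q p"
proof -
  have "eps p q = eps q p" if "p < q" for p q :: nat
    using that by (subst eps.simps) auto
  then show ?thesis by (metis linorder_neqE_nat)
qed

text \<open>One subtraction counts as one, matching one quadratic transform.\<close>

lemma eps_add: "0 < q \<Longrightarrow> eps (p + q) q = Suc (eps p q)"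
  by (subst eps.simps, subst (2) eps.simps) simp

lemma eps_one_one: "eps 1 1 = 1"
  using eps_add[of 1 0] by (simp add: eps.simps)

lemma eps_pos: "0 < p \<Longrightarrow> 0 < q \<Longrightarrow> 0 < eps p q"
proof (induction "p + q" arbitrary: p q rule: less_induct)
  case less
  then show ?case
    using eps_add[of q "p - q"] eps_add[of p "q - p"] eps_commute[of p q] eps_commute[of p "q - p"]
    by (cases "q \<le> p") auto
qed

section \<open>Change of parameters, concatenation of chains, freeness\<close>

lemma regular_params_shift:
  assumes reg: "regular_params A a b" and d: "unit_in A d" and r: "r \<in> A"
  shows "regular_params A a (d * b + a * r)"
proof -
  interpret two_gen_local A a b by (rule regular_params_two_gen_local[OF reg])
  let ?b = "d * b + a * r"
  have dA: "d \<in> A" "inverse d \<in> A" "d \<noteq> 0" using d by (auto simp: unit_in_def)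
  have b'A: "?b \<in> A" using dA r A aA bA by (intro subring_add subring_mult)
  have I: "is_ideal (span2 A a b) A" "is_ideal (span2 A a ?b) A"
    by (rule is_ideal_span2[OF A aA bA], rule is_ideal_span2[OF A aA b'A])
  have "?b \<in> span2 A a b"
    using ideal_add[OF I(1) ideal_mult[OF I(1) dA(1)] ideal_mult_right[OF I(1) r]] span2_gens[OF A] by blast
  moreover have "inverse d * (?b - a * r) \<in> span2 A a ?b"
    using ideal_mult[OF I(2) dA(2) ideal_diff[OF A I(2) _ ideal_mult_right[OF I(2) r]]] span2_gens[OF A] by blast
  then have "b \<in> span2 A a ?b" using dA(3) by (simp add: mult.assoc[symmetric])
  ultimately have "span2 A a ?b = span2 A a b"
    using span2_subset[OF I(1)] span2_subset[OF I(2)] span2_gens[OF A] by blast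
  then have "gen_ideal A {a, ?b} = gen_ideal A {a, b}"
    using gen_ideal_pair[OF A aA] bA b'A by simp
  then show ?thesis using reg b'A unfolding regular_params_def by simp
qed

text \<open>Since the lengths \<open>d i\<close> are positive, the blocks from \<open>K i\<close> up
  to but excluding \<open>K (Suc i)\<close> are nonempty and partition the indices. The end of one
  block and the start of the next are both \<open>A (Suc i)\<close>.\<close>

lemma glue_chains:
  fixes E :: "'b \<Rightarrow> 'b \<Rightarrow> bool" and K :: "nat \<Rightarrow> nat"
  assumes chain: "\<And>i. (E ^^ d i) (A i) (A (Suc i))" and d: "\<And>i. 0 < d i"
    and K: "K 0 = 0" "\<And>i. K (Suc i) = K i + d i"
  obtains R where "\<And>i. R (K i) = A i" "\<And>m. E (R m) (R (Suc m))"
proof -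
  have "\<forall>i. \<exists>f. f 0 = A i \<and> f (d i) = A (Suc i) \<and> (\<forall>j<d i. E (f j) (f (Suc j)))"
    using chain unfolding relpowp_fun_conv by blast
  then obtain f where f: "\<And>i. f i 0 = A i" "\<And>i. f i (d i) = A (Suc i)"
    "\<And>i j. j < d i \<Longrightarrow> E (f i j) (f i (Suc j))"
    by metis
  have K_lt: "K i < K (Suc i)" for i using d[of i] by (simp add: K(2))
  then have "strict_mono K" by (simp add: strict_mono_Suc_iff)
  then have K_mono: "K i \<le> K j" if "i \<le> j" for i j using that by (simp add: strict_mono_less_eq)
  define idx where "idx m = (LEAST i. m < K (Suc i))" for m
  have idx_eq: "idx m = i" if "K i \<le> m" "m < K (Suc i)" for m i
    unfolding idx_def
  proof (rule Least_equality)
    show "m < K (Suc i)" by (rule that(2))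
    fix j assume "m < K (Suc j)"
    then show "i \<le> j" using that(1) K_mono[of "Suc j" i] by (meson leD le_less_trans not_less_eq_eq)
  qed
  have idx_ex: "\<exists>i. K i \<le> m \<and> m < K (Suc i)" for m
  proof (induction m)
    case 0
    then show ?case using K_lt[of 0] K(1) by auto
  next
    case (Suc m)
    then obtain i where i: "K i \<le> m" "m < K (Suc i)" by blast
    then show ?case using K_lt[of "Suc i"] by (cases "Suc m < K (Suc i)") (auto intro: exI[of _ i] exI[of _ "Suc i"])
  qed
  define R where "R m = f (idx m) (m - K (idx m))" for m
  show ?thesis
  proof (rule that)
    show RK: "R (K i) = A i" for i
      using idx_eq[of i "K i"] K_lt f(1) by (simp add: R_def)
    fix m
    obtain i where i: "K i \<le> m" "m < K (Suc i)" using idx_ex by blast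
    have Rm: "R m = f i (m - K i)" using idx_eq[OF i] by (simp add: R_def)
    show "E (R m) (R (Suc m))"
    proof (cases "Suc m < K (Suc i)")
      case True
      then have "R (Suc m) = f i (Suc (m - K i))"
        using idx_eq[of i "Suc m"] i by (simp add: R_def Suc_diff_le)
      then show ?thesis using Rm f(3)[of "m - K i" i] i K(2) by simp
    next
      case False
      then have Sm: "Suc m = K (Suc i)" using i by simp
      then have "R (Suc m) = f i (d i)" using RK[of "Suc i"] f(2) by simp
      moreover have "d i = Suc (m - K i)" using Sm K(2)[of i] i by simp
      ultimately show ?thesis using Rm f(3)[of "m - K i" i] by simp
    qed
  qed
qed

text \<open>Up to a unit, x is a positive power of u, so the same primes contain both; this serves
  \<open>free\<close> as well as \<open>exceptional\<close>.\<close>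

lemma prime_over_principal_power:
  assumes A: "subring A" and u: "u \<in> A" and \<gamma>: "unit_in A \<gamma>" and x: "x = u ^ e * \<gamma>" and e: "0 < e"
    and P: "prime_ideal P A"
  shows "gen_ideal A {x} \<subseteq> P \<longleftrightarrow> u \<in> P"
proof -
  have PI: "is_ideal P A" using P by (simp add: prime_ideal_def)
  have \<gamma>A: "\<gamma> \<in> A" "inverse \<gamma> \<in> A" "\<gamma> \<noteq> 0" using \<gamma> by (auto simp: unit_in_def)
  have "gen_ideal A {x} \<subseteq> P \<longleftrightarrow> x \<in> P"
    using gen_ideal_least[OF PI, of "{x}"] gen_ideal_superset[of "{x}" A] by blast
  also have "\<dots> \<longleftrightarrow> u \<in> P"
  proof
    assume "x \<in> P"
    then have "x * inverse \<gamma> \<in> P" using ideal_mult_right[OF PI \<gamma>A(2)] by blast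
    then have "u ^ e \<in> P" using \<gamma>A(3) by (simp add: x mult.assoc)
    then show "u \<in> P" by (rule prime_power_mem[OF P A u])
  next
    assume uP: "u \<in> P"
    obtain e' where "e = Suc e'" using e gr0_conv_Suc by blast
    then have "x = u * (u ^ e' * \<gamma>)" by (simp add: x)
    then show "x \<in> P"
      using ideal_mult_right[OF PI subring_mult[OF A subring_power[OF A u] \<gamma>A(1)] uP] by simp
  qed
  finally show ?thesis .
qed

text \<open>Every prime containing x contains u, so the prime uA is the least of them.\<close>

lemma free_principal_power:
  assumes A: "subring A" and prime: "prime_ideal ((*) u ` A) A"
    and u: "u \<in> A" and \<gamma>: "unit_in A \<gamma>" and x: "x = u ^ e * \<gamma>" and e: "0 < e"
  shows "free A x"
  unfolding free_def minimal_primes_over_def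
proof (rule ex1I[of _ "(*) u ` A"])
  note over = prime_over_principal_power[OF A u \<gamma> x e]
  have u_mem: "u \<in> (*) u ` A" using subring_one[OF A] by force
  have least: "(*) u ` A \<subseteq> P" if "prime_ideal P A" "gen_ideal A {x} \<subseteq> P" for P
    using that over by (intro principal_subset) (auto simp: prime_ideal_def)
  show "(*) u ` A \<in> {P. prime_ideal P A \<and> gen_ideal A {x} \<subseteq> P \<and>
      (\<forall>Q. prime_ideal Q A \<and> gen_ideal A {x} \<subseteq> Q \<and> Q \<subseteq> P \<longrightarrow> Q = P)}"
    using prime over[OF prime] u_mem least by blast
  fix P assume "P \<in> {P. prime_ideal P A \<and> gen_ideal A {x} \<subseteq> P \<and>
      (\<forall>Q. prime_ideal Q A \<and> gen_ideal A {x} \<subseteq> Q \<and> Q \<subseteq> P \<longrightarrow> Q = P)}"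
  then show "P = (*) u ` A" using prime over[OF prime] u_mem least by blast
qed

lemma prod_monomial:
  fixes T :: "nat \<Rightarrow> 'a::field"
  assumes A: "subring A" and T: "\<And>j. j < m \<Longrightarrow> \<exists>e \<gamma>. unit_in A \<gamma> \<and> T j = u ^ e * \<gamma>"
  shows "\<exists>e \<gamma>. unit_in A \<gamma> \<and> (\<Prod>j<m. T j ^ f j) = u ^ e * \<gamma>"
proof -
  have "l \<le> m \<Longrightarrow> \<exists>e \<gamma>. unit_in A \<gamma> \<and> (\<Prod>j<l. T j ^ f j) = u ^ e * \<gamma>" for l
  proof (induction l)
    case 0
    have "(\<Prod>j<0. T j ^ f j) = u ^ 0 * 1" by simp
    then show ?case using unit_in_one[OF A] by blast
  next
    case (Suc l)
    then obtain e \<gamma> where 1: "unit_in A \<gamma>" "(\<Prod>j<l. T j ^ f j) = u ^ e * \<gamma>"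
      using Suc_leD by blast
    obtain e' \<gamma>' where 2: "unit_in A \<gamma>'" "T l = u ^ e' * \<gamma>'" using T Suc.prems Suc_le_lessD by blast
    have "(\<Prod>j<Suc l. T j ^ f j) = u ^ (e + e' * f l) * (\<gamma> * \<gamma>' ^ f l)"
      by (simp add: 1(2) 2(2) power_add power_mult power_mult_distrib)
    then show ?case using unit_in_mult[OF A 1(1) unit_in_power[OF A 2(1)]] by blast
  qed
  then show ?thesis by blast
qed

section \<open>Blow-ups along the Euclidean algorithm\<close>

context rational_valuation
begin

lemma unit_in_dominated_iff:
  assumes "dominated A \<nu>" "z \<in> A" "z \<noteq> 0"
  shows "unit_in A z \<longleftrightarrow> \<nu> z = 0"
  using assms unit_iff_not_max[OF assms(2)] dominated_max_ideal[OF assms(1)] unit_in_notin_val_max(2)[of A z]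
  by (auto simp: dominated_def val_ring_def val_max_def)

text \<open>b / a has positive value, so its residue is 0 and no translation occurs.\<close>

lemma blowup_strict:
  assumes reg: "regular_params A a b" and kA: "k \<subseteq> A" and dom: "dominated A \<nu>" and less: "\<nu> a < \<nu> b"
  obtains A' where "quadratic_transform \<nu> A A'" "regular_params A' a (b / a)" "k \<subseteq> A'"
    "dominated A' \<nu>" "A \<subseteq> A'"
proof -
  obtain A' c where A': "quadratic_transform \<nu> A A'" "regular_params A' a (b / a - c)" "k \<subseteq> A'"
    "dominated A' \<nu>" "A \<subseteq> A'" "c \<in> k" "b / a - c \<in> val_max \<nu>"
    using blowup[OF reg kA dom less_imp_le[OF less]] by metis
  have "b / a \<in> val_max \<nu>"
    using less regular_params_nonzero[OF reg] \<nu>_divide[of b a] by (simp add: val_max_def)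
  then have "b / a - (b / a - c) \<in> val_max \<nu>"
    using ideal_diff[OF subring_val_ring is_ideal_val_max _ A'(7)] by blast
  then have "c = 0" using const_val_max A'(6) by simp
  then show ?thesis using that A' by simp
qed

text \<open>The quotient \<open>b ^ q / a ^ p\<close> is invariant under the monomial blow-ups of the Euclidean
  algorithm, and becomes the quotient of the two parameters once their values agree.\<close>
lemma euclidean_blowups:
  assumes "regular_params A a b" "k \<subseteq> A" "dominated A \<nu>"
    and "\<nu> a = of_nat q * w" "\<nu> b = of_nat p * w" "0 < p" "0 < q" "coprime p q" "0 < w"
  shows "\<exists>A' s c. (quadratic_transform \<nu> ^^ eps p q) A A' \<and> regular_params A' s (b ^ q / a ^ p - c)
    \<and> k \<subseteq> A' \<and> dominated A' \<nu> \<and> A \<subseteq> A' \<and> c \<in> k \<and> \<nu> s = w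
    \<and> unit_in A' (a / s ^ q) \<and> unit_in A' (b / s ^ p)"
  using assms
proof (induction "p + q" arbitrary: A a b p q rule: less_induct)
  case less
  note prems = less.prems
  have nz: "a \<noteq> 0" "b \<noteq> 0" using regular_params_nonzero[OF prems(1)] by auto
  consider "p = q" | "q < p" | "p < q" by linarith
  then show ?case
  proof cases
    \<comment> \<open>Equal coprime numbers are both 1. A single blow-up with s = a remains, and it
      is here that the constant c arises.\<close>
    case 1
    then have pq: "p = 1" "q = 1" using prems(8) by auto
    have \<nu>: "\<nu> a = w" "\<nu> b = w" using prems(4,5) pq by auto
    obtain A' c where A': "quadratic_transform \<nu> A A'" "regular_params A' a (b / a - c)" "k \<subseteq> A'"
      "dominated A' \<nu>" "A \<subseteq> A'" "b / a \<in> A'" "c \<in> k"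
      using blowup[OF prems(1-3)] \<nu> by (metis order_refl)
    have "subring A'" using A'(2) by (simp add: regular_params_def local_ring_def)
    moreover have "unit_in A' (b / a)"
      using unit_in_dominated_iff[OF A'(4,6)] nz \<nu> \<nu>_divide[of b a] by simp
    moreover have "(quadratic_transform \<nu> ^^ eps p q) A A'"
      unfolding pq eps_one_one relpowp_1 by (rule A'(1))
    ultimately show ?thesis
      by - (rule exI[of _ A'], rule exI[of _ a], rule exI[of _ c],
        use A' nz \<nu> unit_in_one[of A'] in \<open>simp add: pq\<close>)
  next
    case 2
    then obtain p' where p: "p = p' + q" "0 < p'" by (metis add.commute less_imp_add_positive)
    have "\<nu> a < \<nu> b" using 2 prems(4,5,9) by simp
    then obtain A1 where A1: "quadratic_transform \<nu> A A1" "regular_params A1 a (b / a)" "k \<subseteq> A1"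
      "dominated A1 \<nu>" "A \<subseteq> A1"
      using blowup_strict[OF prems(1-3)] by metis
    have "\<nu> (b / a) = of_nat p' * w"
      using \<nu>_divide[OF nz(2,1)] prems(4,5) by (simp add: p algebra_simps)
    moreover have "coprime p' q" using prems(8) unfolding p(1) coprime_iff_gcd_eq_1 by simp
    ultimately obtain A' s c where A': "(quadratic_transform \<nu> ^^ eps p' q) A1 A'"
      "regular_params A' s ((b / a) ^ q / a ^ p' - c)" "k \<subseteq> A'" "dominated A' \<nu>" "A1 \<subseteq> A'"
      "c \<in> k" "\<nu> s = w" "unit_in A' (a / s ^ q)" "unit_in A' (b / a / s ^ p')"
      using less.hyps[of p' q A1 a "b / a"] A1(2-4) prems(4,7,9) p by auto
    have "(quadratic_transform \<nu> ^^ eps p q) A A'"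
      unfolding p(1) eps_add[OF prems(7)] using A1(1) A'(1) by (rule relpowp_Suc_I2)
    moreover have "(b / a) ^ q / a ^ p' = b ^ q / a ^ p" by (simp add: p power_add power_divide mult.commute)
    moreover have "subring A'" using A'(2) by (simp add: regular_params_def local_ring_def)
    then have "unit_in A' (b / a / s ^ p' * (a / s ^ q))" using unit_in_mult A'(8,9) by blast
    moreover have "b / a / s ^ p' * (a / s ^ q) = b / s ^ p" using nz by (simp add: p power_add)
    ultimately show ?thesis
      by - (rule exI[of _ A'], rule exI[of _ s], rule exI[of _ c], use A' A1(5) in auto)
  next
    case 3
    then obtain q' where q: "q = q' + p" "0 < q'" by (metis add.commute less_imp_add_positive)
    have "\<nu> b < \<nu> a" using 3 prems(4,5,9) by simp
    then obtain A1 where A1: "quadratic_transform \<nu> A A1" "regular_params A1 b (a / b)" "k \<subseteq> A1"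
      "dominated A1 \<nu>" "A \<subseteq> A1"
      using blowup_strict[of A b a] prems(1-3) regular_params_commute by metis
    \<comment> \<open>Taking a / b as first and b as second parameter keeps b in the numerator of
      the invariant quotient.\<close>
    have reg1: "regular_params A1 (a / b) b" using A1(2) regular_params_commute by blast
    have "\<nu> (a / b) = of_nat q' * w"
      using \<nu>_divide[OF nz] prems(4,5) by (simp add: q algebra_simps)
    moreover have "coprime p q'"
      using prems(8) unfolding q(1) coprime_iff_gcd_eq_1 by (simp add: gcd.commute[of p])
    ultimately obtain A' s c where A': "(quadratic_transform \<nu> ^^ eps p q') A1 A'"
      "regular_params A' s (b ^ q' / (a / b) ^ p - c)" "k \<subseteq> A'" "dominated A' \<nu>" "A1 \<subseteq> A'"
      "c \<in> k" "\<nu> s = w" "unit_in A' (a / b / s ^ q')" "unit_in A' (b / s ^ p)"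
      using less.hyps[of p q' A1 "a / b" b] reg1 A1(3,4) prems(5,6,9) q by auto
    have "eps p q = Suc (eps p q')"
      using eps_add[OF prems(6), of q'] eps_commute[of p] by (simp add: q)
    then have "(quadratic_transform \<nu> ^^ eps p q) A A'"
      using relpowp_Suc_I2[OF A1(1) A'(1)] by simp
    moreover have "b ^ q' / (a / b) ^ p = b ^ q / a ^ p" by (simp add: q power_add power_divide)
    moreover have "subring A'" using A'(2) by (simp add: regular_params_def local_ring_def)
    then have "unit_in A' (a / b / s ^ q' * (b / s ^ p))" using unit_in_mult A'(8,9) by blast
    moreover have "a / b / s ^ q' * (b / s ^ p) = a / s ^ q" using nz by (simp add: q power_add)
    ultimately show ?thesis
      by - (rule exI[of _ A'], rule exI[of _ s], rule exI[of _ c], use A' A1(5) in auto)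
  qed
qed

end

subsection \<open>Jumping polynomials\<close>

locale jumping_polynomials = rational_valuation +
  fixes S :: "'a::field set" and x y :: 'a and T lam :: "nat \<Rightarrow> 'a"
    and p q :: "nat \<Rightarrow> nat" and n :: "nat \<Rightarrow> nat \<Rightarrow> nat"
  assumes S_params: "regular_params S x y" and k_S: "k \<subseteq> S" and S_dom: "dominated S \<nu>"
    and \<nu>_x: "\<nu> x = 1" and jumping: "jumping_polys k \<nu> x y T p q n lam"
begin

lemma T_0: "T 0 = x" and T_1: "T (Suc 0) = y"
  using jumping by (auto simp: jumping_polys_def)

lemma p_q: "0 < p (Suc i)" "0 < q (Suc i)" "coprime (p (Suc i)) (q (Suc i))"
proof -
  have "0 < p (Suc i) \<and> 0 < q (Suc i) \<and> coprime (p (Suc i)) (q (Suc i))"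
    using jumping by (cases i) (auto simp: jumping_polys_def)
  then show "0 < p (Suc i)" "0 < q (Suc i)" "coprime (p (Suc i)) (q (Suc i))" by auto
qed

lemma \<nu>_y: "\<nu> y = of_nat (p 1) / of_nat (q 1)"
  using jumping by (simp add: jumping_polys_def)

lemma T_relation: "of_nat (q (Suc i)) * \<nu> (T (Suc i)) = (\<Sum>j<Suc i. of_nat (n (Suc i) j) * \<nu> (T j))"
  and T_residue: "residue_is \<nu> k (T (Suc i) ^ q (Suc i) / (\<Prod>j<Suc i. T j ^ n (Suc i) j)) (lam (Suc i))"
  and T_rec: "T (Suc (Suc i)) = T (Suc i) ^ q (Suc i) - lam (Suc i) * (\<Prod>j<Suc i. T j ^ n (Suc i) j)"
  and \<nu>_T_rec: "\<nu> (T (Suc (Suc i))) = of_nat (q (Suc i)) * \<nu> (T (Suc i))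
      + (1 / of_nat (Qp q (Suc i))) * (of_nat (p (Suc (Suc i))) / of_nat (q (Suc (Suc i))))"
proof -
  have "1 \<le> Suc i" by simp
  with jumping[unfolded jumping_polys_def, THEN conjunct2, THEN conjunct2, THEN conjunct2,
    THEN conjunct2, THEN conjunct2, THEN conjunct2, THEN spec, THEN mp, of "Suc i"]
  show "of_nat (q (Suc i)) * \<nu> (T (Suc i)) = (\<Sum>j<Suc i. of_nat (n (Suc i) j) * \<nu> (T j))"
    "residue_is \<nu> k (T (Suc i) ^ q (Suc i) / (\<Prod>j<Suc i. T j ^ n (Suc i) j)) (lam (Suc i))"
    "T (Suc (Suc i)) = T (Suc i) ^ q (Suc i) - lam (Suc i) * (\<Prod>j<Suc i. T j ^ n (Suc i) j)"
    "\<nu> (T (Suc (Suc i))) = of_nat (q (Suc i)) * \<nu> (T (Suc i))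
      + (1 / of_nat (Qp q (Suc i))) * (of_nat (p (Suc (Suc i))) / of_nat (q (Suc (Suc i))))"
    by blast+
qed

lemma Qp_Suc: "Qp q (Suc i) = Qp q i * q (Suc i)"
  by (simp add: Qp_def)

lemma Qp_pos: "0 < Qp q i"
  by (induction i) (simp_all add: Qp_Suc p_q, simp add: Qp_def)

lemma jump_pos:
  "(0 :: rat) < (1 / of_nat (Qp q i)) * (of_nat (p (Suc i)) / of_nat (q (Suc i)))"
  using Qp_pos[of i] p_q(1,2)[of i] by simp

lemma \<nu>_T_pos: "0 < \<nu> (T i)"
proof (cases i)
  case 0
  then show ?thesis by (simp add: T_0 \<nu>_x)
next
  case (Suc m)
  have "0 < \<nu> (T (Suc m))"
  proof (induction m)
    case 0
    then show ?case using p_q(1,2)[of 0] \<nu>_y by (simp add: T_1)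
  next
    case (Suc m)
    then show ?case using \<nu>_T_rec[of m] jump_pos[of "Suc m"]
      by (simp add: add_nonneg_pos del: times_divide_eq_right times_divide_eq_left)
  qed
  then show ?thesis using Suc by simp
qed

text \<open>The value assigned to \<open>0\<close> is arbitrary, so \<open>T i \<noteq> 0\<close> needs the strict growth of the values.\<close>
lemma T_nonzero: "T i \<noteq> 0"
proof (cases i)
  case 0
  then show ?thesis using regular_params_nonzero[OF S_params] by (simp add: T_0)
next
  case (Suc m)
  have "T (Suc m) \<noteq> 0"
  proof
    \<comment> \<open>A vanishing T makes its quotient and hence its residue lam vanish, so the next
      T vanishes too. Both then carry the same assigned value, whereas \<open>\<nu>_T_rec\<close>
      makes that value grow strictly.\<close>
    assume T0: "T (Suc m) = 0"
    have "lam (Suc m) \<in> k" "- lam (Suc m) \<in> val_max \<nu>"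
      using T_residue[of m] p_q(2)[of m] by (auto simp: T0 residue_is_def power_0_left)
    then have "lam (Suc m) = 0"
      using const_val_max[of "- lam (Suc m)"] subring_uminus[OF subring_k] by simp
    then have "T (Suc (Suc m)) = T (Suc m)"
      using T_rec[of m] p_q(2)[of m] by (simp add: T0 power_0_left)
    then have "\<nu> (T (Suc m)) > of_nat (q (Suc m)) * \<nu> (T (Suc m))"
      using \<nu>_T_rec[of m] jump_pos[of "Suc m"] by simp
    moreover have "of_nat (q (Suc m)) * \<nu> (T (Suc m)) \<ge> 1 * \<nu> (T (Suc m))"
      using p_q(2)[of m] \<nu>_T_pos[of "Suc m"] by (intro mult_right_mono) (auto simp: Suc_le_eq)
    ultimately show False by simp
  qed
  then show ?thesis using Suc by simp
qed

definition D :: "nat \<Rightarrow> 'a" where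
  "D i = (\<Prod>j<i. T j ^ n i j)"

text \<open>The empty product \<open>D 0\<close> is 1, so \<open>Y 0\<close> is y and the initial
  pair (x, y) fits the pattern as stage 0.\<close>

definition Y :: "nat \<Rightarrow> 'a" where
  "Y i = T (Suc i) / D i"

lemma D_nonzero: "D i \<noteq> 0"
  by (simp add: D_def T_nonzero)

lemma \<nu>_D: "\<nu> (D (Suc i)) = of_nat (q (Suc i)) * \<nu> (T (Suc i))"
  unfolding D_def T_relation by (subst \<nu>_prod) (auto simp: T_nonzero \<nu>_power)

lemma T_eq: "T (Suc i) = Y i * D i"
  by (simp add: Y_def D_nonzero)

lemma Y_nonzero: "Y i \<noteq> 0"
  by (simp add: Y_def T_nonzero D_nonzero)

text \<open>Beyond index 0, \<open>D i\<close> has the value of \<open>T i ^ q i\<close>, which is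
  the first summand of \<open>\<nu>_T_rec\<close> and cancels.\<close>

lemma \<nu>_Y: "\<nu> (Y i) = (1 / of_nat (Qp q i)) * (of_nat (p (Suc i)) / of_nat (q (Suc i)))"
proof (cases i)
  case 0
  then show ?thesis by (simp add: Y_def D_def T_1 \<nu>_y Qp_def)
next
  case (Suc m)
  have "\<nu> (Y i) = \<nu> (T (Suc i)) - \<nu> (D i)" unfolding Y_def by (rule \<nu>_divide[OF T_nonzero D_nonzero])
  then show ?thesis unfolding Suc \<nu>_D \<nu>_T_rec by simp
qed

text \<open>A quotient minus its residue: the shape to be compared with the second parameter left by
  \<open>euclidean_blowups\<close>.\<close>

lemma Y_Suc: "Y (Suc i) = T (Suc i) ^ q (Suc i) / D (Suc i) - lam (Suc i)"
  unfolding Y_def T_rec using D_nonzero[of "Suc i"] by (simp add: D_def diff_divide_distrib)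

text \<open>The invariant carried from block to block. The exponents e stay existential because
  \<open>\<nu> u\<close> determines them.\<close>

definition stage :: "nat \<Rightarrow> 'a set \<Rightarrow> 'a \<Rightarrow> bool" where
  "stage i A u \<longleftrightarrow> regular_params A u (Y i) \<and> k \<subseteq> A \<and> dominated A \<nu> \<and> \<nu> u = 1 / of_nat (Qp q i)
     \<and> (\<forall>j\<le>i. \<exists>e \<gamma>. unit_in A \<gamma> \<and> T j = u ^ e * \<gamma>)"

lemma stage_0: "stage 0 S x"
  unfolding stage_def
proof (intro conjI allI impI)
  show "regular_params S x (Y 0)" using S_params by (simp add: Y_def D_def T_1)
  fix j :: nat assume "j \<le> 0"
  then show "\<exists>e \<gamma>. unit_in S \<gamma> \<and> T j = x ^ e * \<gamma>"
    using S_params by (intro exI[of _ 1]) (auto simp: T_0 regular_params_def intro!: unit_in_one local_subring)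
qed (simp_all add: k_S S_dom \<nu>_x Qp_def)

lemma stage_Suc:
  assumes "stage i A u"
  shows "\<exists>A' u'. (quadratic_transform \<nu> ^^ eps (p (Suc i)) (q (Suc i))) A A' \<and> stage (Suc i) A' u'"
proof -
  have reg: "regular_params A u (Y i)" and kA: "k \<subseteq> A" and dom: "dominated A \<nu>"
    and \<nu>_u: "\<nu> u = 1 / of_nat (Qp q i)"
    and T_mono: "\<And>j. j \<le> i \<Longrightarrow> \<exists>e \<gamma>. unit_in A \<gamma> \<and> T j = u ^ e * \<gamma>"
    using assms unfolding stage_def by auto
  interpret two_gen_local A u "Y i" by (rule regular_params_two_gen_local[OF reg])
  define P Q where "P = p (Suc i)" and "Q = q (Suc i)"
  have PQ: "0 < P" "0 < Q" "coprime P Q" using p_q[of i] by (auto simp: P_def Q_def)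
  \<comment> \<open>w is the value intended for the next exceptional parameter; the values of u and
    \<open>Y i\<close> are its multiples by the coprime integers Q and P.\<close>
  define w :: rat where "w = 1 / of_nat (Qp q (Suc i))"
  have w: "0 < w" using Qp_pos[of "Suc i"] by (simp add: w_def)
  have \<nu>: "\<nu> u = of_nat Q * w" "\<nu> (Y i) = of_nat P * w"
    using PQ(2) by (simp_all add: \<nu>_u \<nu>_Y w_def Qp_Suc flip: P_def Q_def)
  obtain A' s c where A': "(quadratic_transform \<nu> ^^ eps P Q) A A'"
    "regular_params A' s (Y i ^ Q / u ^ P - c)" "k \<subseteq> A'" "dominated A' \<nu>" "A \<subseteq> A'" "c \<in> k" "\<nu> s = w"
    "unit_in A' (u / s ^ Q)" "unit_in A' (Y i / s ^ P)"
    using euclidean_blowups[OF reg kA dom \<nu> PQ w] by blast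
  interpret A': two_gen_local A' s "Y i ^ Q / u ^ P - c"
    by (rule regular_params_two_gen_local[OF A'(2)])
  have u_nz: "u \<noteq> 0" and s_nz: "s \<noteq> 0"
    using regular_params_nonzero[OF reg] regular_params_nonzero[OF A'(2)] by auto
  define v v' where "v = u / s ^ Q" and "v' = Y i / s ^ P"
  have v: "unit_in A' v" "u = s ^ Q * v" and v': "unit_in A' v'" "Y i = s ^ P * v'"
    using A'(8,9) s_nz by (simp_all add: v_def v'_def)
  obtain d \<delta> where \<delta>: "unit_in A \<delta>" "D i = u ^ d * \<delta>"
    using prod_monomial[OF A, of i T u "n i"] T_mono unfolding D_def by fastforce
  obtain e \<delta>' where \<delta>': "unit_in A \<delta>'" "D (Suc i) = u ^ e * \<delta>'"
    using prod_monomial[OF A, of "Suc i" T u "n (Suc i)"] T_mono unfolding D_def by fastforce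

  have T_mono': "\<exists>e \<gamma>. unit_in A' \<gamma> \<and> T j = s ^ e * \<gamma>" if "j \<le> Suc i" for j
  proof (cases "j \<le> i")
    case True
    then obtain f \<gamma> where f: "unit_in A \<gamma>" "T j = u ^ f * \<gamma>" using T_mono by blast
    have "T j = s ^ (Q * f) * (v ^ f * \<gamma>)" by (simp add: f(2) v(2) power_mult power_mult_distrib)
    moreover have "unit_in A' (v ^ f * \<gamma>)"
      using unit_in_mult[OF A'.A unit_in_power[OF A'.A v(1)] unit_in_mono[OF f(1) A'(5)]] .
    ultimately show ?thesis by blast
  next
    case False
    \<comment> \<open>Here j is Suc i, and \<open>T (Suc i)\<close> is \<open>Y i\<close> times the
      monomial \<open>D i\<close> in u.\<close>
    then have "T j = s ^ (P + Q * d) * (v' * v ^ d * \<delta>)"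
      using that T_eq[of i] \<delta>(2) by (simp add: le_Suc_eq v'(2) v(2) power_add power_mult power_mult_distrib)
    moreover have "unit_in A' (v' * v ^ d * \<delta>)"
      using unit_in_mult[OF A'.A unit_in_mult[OF A'.A v'(1) unit_in_power[OF A'.A v(1)]]
        unit_in_mono[OF \<delta>(1) A'(5)]] .
    ultimately show ?thesis by blast
  qed

  \<comment> \<open>\<open>W = Z * \<eta>\<close> with \<open>\<eta>\<close> a unit of \<open>A\<close>. The residue \<open>d'\<close> of \<open>\<eta>\<close> differs from \<open>\<eta>\<close> by an element of the
    maximal ideal of \<open>A\<close>, which \<open>s\<close> divides in \<open>A'\<close>; so \<open>W - lam (Suc i)\<close> is \<open>d' * (Z - c)\<close> modulo \<open>s\<close>.\<close>
  define W Z \<eta> where "W = T (Suc i) ^ Q / D (Suc i)" and "Z = Y i ^ Q / u ^ P" and "\<eta> = \<delta> ^ Q / \<delta>'"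
  have \<eta>: "unit_in A \<eta>" unfolding \<eta>_def using \<delta>(1) \<delta>'(1) by (intro unit_in_divide[OF A] unit_in_power[OF A])
  have A_val: "A \<subseteq> val_ring \<nu>" using dom by (simp add: dominated_def)
  \<comment> \<open>\<open>D (Suc i)\<close> and \<open>T (Suc i) ^ Q\<close> have equal values.
    This fixes e, and after cancellation exactly u ^ P remains in the denominator of W, as in
    Z.\<close>
  have e: "e = P + d * Q"
  proof -
    have units: "\<delta> \<noteq> 0" "\<delta>' \<noteq> 0" "\<nu> \<delta> = 0" "\<nu> \<delta>' = 0"
      using \<delta>(1) \<delta>'(1) unit_in_notin_val_max(2)[OF A_val] by (auto simp: unit_in_def)
    have "\<nu> (T (Suc i)) = of_nat P * w + of_nat d * (of_nat Q * w)"
      unfolding T_eq \<delta>(2) using Y_nonzero u_nz units \<nu> by (simp add: \<nu>_mult \<nu>_power)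
    moreover have "\<nu> (D (Suc i)) = of_nat e * (of_nat Q * w)"
      unfolding \<delta>'(2) using u_nz units \<nu> by (simp add: \<nu>_mult \<nu>_power)
    ultimately have "of_nat e * (of_nat Q * w) = of_nat Q * (of_nat P * w + of_nat d * (of_nat Q * w))"
      using \<nu>_D[of i, folded Q_def] by metis
    then have "of_nat e * (of_nat Q * w) = (of_nat P + of_nat d * of_nat Q) * (of_nat Q * w)"
      by (simp add: algebra_simps)
    then have "(of_nat e :: rat) = of_nat P + of_nat d * of_nat Q"
      using w PQ(2) by (subst (asm) mult_cancel_right) simp
    then have "(of_nat e :: rat) = of_nat (P + d * Q)" by simp
    then show ?thesis by (simp only: of_nat_eq_iff)
  qed
  have W: "W = Z * \<eta>"
    unfolding W_def Z_def \<eta>_def \<delta>'(2) T_eq \<delta>(2) e using u_nz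
    by (simp add: power_mult_distrib power_add power_mult[symmetric])
  have W_lam: "W - lam (Suc i) \<in> val_max \<nu>" and lam_k: "lam (Suc i) \<in> k"
    using T_residue[of i] unfolding residue_is_def W_def D_def Q_def by auto
  have Z_c: "Z - c \<in> A'" "Z - c \<in> val_max \<nu>"
    using A'.bA A'.b_max A'(4) unfolding Z_def dominated_def by auto
  have Z: "Z \<in> A'" using subring_add[OF A'.A Z_c(1), of c] A'(3,6) by auto
  obtain d' where d': "d' \<in> k" "\<eta> - d' \<in> max_ideal A"
    using residue_field_local[OF kA A dom] \<eta> unfolding unit_in_def by metis
  have d'_nz: "d' \<noteq> 0" using d'(2) \<eta> by (auto simp: max_ideal_def)
  have pow_s: "s ^ m * z \<in> (*) s ` A'" if "0 < m" "z \<in> A'" for m z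
  proof -
    obtain m' where "m = Suc m'" using \<open>0 < m\<close> gr0_conv_Suc by blast
    then have "s ^ m * z = s * (s ^ m' * z)" by simp
    moreover have "s ^ m' * z \<in> A'" using that(2) A'.A A'.aA by (intro subring_mult subring_power)
    ultimately show ?thesis by blast
  qed
  \<comment> \<open>P and Q are positive, so s divides both generators u and \<open>Y i\<close> of
    the maximal ideal of A.\<close>
  have "u \<in> (*) s ` A'" "Y i \<in> (*) s ` A'"
    unfolding v(2) v'(2) using pow_s PQ v(1) v'(1) by (auto simp: unit_in_def)
  then have "span2 A' u (Y i) \<subseteq> (*) s ` A'" by (rule span2_subset[OF A'.pa])
  moreover have "max_ideal A \<subseteq> span2 A' u (Y i)" unfolding gens span2_def using A'(5) by blast
  ultimately obtain g where g: "g \<in> A'" "\<eta> - d' = s * g" using d'(2) by blast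
  define h where "h = g * Z"
  have hA: "h \<in> A'" unfolding h_def by (rule subring_mult[OF A'.A g(1) Z])
  have eq: "W - lam (Suc i) = d' * (Z - c) + s * h + (d' * c - lam (Suc i))"
  proof -
    have "\<eta> = d' + s * g" using g(2) by (simp add: algebra_simps)
    then show ?thesis unfolding W h_def by (simp add: algebra_simps)
  qed
  \<comment> \<open>By \<open>eq\<close> this constant is a difference of elements of positive value
    or 0, and a nonzero constant has value 0.\<close>
  have "d' * c - lam (Suc i) = 0"
  proof (rule const_val_max)
    show "d' * c - lam (Suc i) \<in> k" using d'(1) A'(6) lam_k subring_k by (intro subring_diff subring_mult)
    have "d' * (Z - c) + s * h \<in> max_ideal A'"
      using A'(3) d'(1) A'.a_max A'.b_max hA max_ideal_ideal[OF A'.loc] unfolding Z_def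
      by (blast intro: ideal_add ideal_mult ideal_mult_right)
    then have "d' * (Z - c) + s * h \<in> val_max \<nu>" using A'(4) by (auto simp: dominated_def)
    then have "(W - lam (Suc i)) - (d' * (Z - c) + s * h) \<in> val_max \<nu>"
      by (rule ideal_diff[OF subring_val_ring is_ideal_val_max W_lam])
    then show "d' * c - lam (Suc i) \<in> val_max \<nu>" unfolding eq by simp
  qed
  then have Y': "Y (Suc i) = d' * (Z - c) + s * h"
    using eq by (simp add: Y_Suc W_def Q_def)
  have "inverse d' \<in> k" using subfield_k d'(1) d'_nz by (simp add: subfield_def)
  then have "unit_in A' d'" using d'(1) d'_nz A'(3) by (auto simp: unit_in_def)
  then have "regular_params A' s (Y (Suc i))"
    unfolding Y' using regular_params_shift[OF A'(2) _ hA] by (simp add: Z_def)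
  then have "stage (Suc i) A' s"
    unfolding stage_def using A'(3,4,7) T_mono' by (simp add: w_def)
  then show ?thesis using A'(1) unfolding P_def Q_def by blast
qed

text \<open>The claims about the curve x = 0 come from the case j = 0 of the invariant: x is
  \<open>T 0\<close>, hence a power of u times a unit.\<close>

lemma stage_conclusion:
  assumes "stage i A u"
  shows "free A x" "regular_params A u (Y i)" "exceptional A x u"
    "\<forall>j\<le>i. \<exists>\<gamma> (e::nat). unit_in A \<gamma> \<and> of_nat e = of_nat (Qp q i) * \<nu> (T j) \<and> T j = u ^ e * \<gamma>"
    "\<nu> u = 1 / of_nat (Qp q i)" "strict_transform A u (T (Suc i)) (Y i)"
proof -
  have dom: "dominated A \<nu>"
    and T_mono: "\<And>j. j \<le> i \<Longrightarrow> \<exists>e \<gamma>. unit_in A \<gamma> \<and> T j = u ^ e * \<gamma>"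
    using assms unfolding stage_def by auto
  show reg: "regular_params A u (Y i)" and \<nu>_u: "\<nu> u = 1 / of_nat (Qp q i)"
    using assms unfolding stage_def by auto
  interpret two_gen_local A u "Y i" by (rule regular_params_two_gen_local[OF reg])
  have u_nz: "u \<noteq> 0" using regular_params_nonzero[OF reg] by blast
  have A_val: "A \<subseteq> val_ring \<nu>" using dom by (simp add: dominated_def)
  \<comment> \<open>Units have value 0 and \<nu> u is 1 / \<open>Qp q i\<close>, so the exponent is
    forced.\<close>
  have exponent: "of_nat e = of_nat (Qp q i) * \<nu> (T j)" if "unit_in A \<gamma>" "T j = u ^ e * \<gamma>" for e \<gamma> j
  proof -
    have "\<nu> (T j) = of_nat e * \<nu> u"
      using that(1) u_nz unit_in_notin_val_max(2)[OF A_val that(1)]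
      unfolding that(2) by (simp add: \<nu>_mult \<nu>_power unit_in_def)
    then show ?thesis using Qp_pos[of i] by (simp add: \<nu>_u)
  qed
  show "\<forall>j\<le>i. \<exists>\<gamma> (e::nat). unit_in A \<gamma> \<and> of_nat e = of_nat (Qp q i) * \<nu> (T j) \<and> T j = u ^ e * \<gamma>"
    using T_mono exponent by metis
  obtain e \<gamma> where e: "unit_in A \<gamma>" "T 0 = u ^ e * \<gamma>" using T_mono by blast
  have x: "x = u ^ e * \<gamma>" using e(2) T_0 by simp
  have "(of_nat e :: rat) > 0" using exponent[OF e] Qp_pos[of i] by (simp add: T_0 \<nu>_x)
  then have e_pos: "0 < e" by simp
  show "free A x"
    using free_principal_power[OF A regular_params_prime[OF reg] aA e(1) x e_pos] .
  show "exceptional A x u"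
    unfolding exceptional_def
    using prime_over_principal_power[OF A aA e(1) x e_pos] gen_ideal_superset[of "{x}" A] by blast
  obtain d \<delta> where \<delta>: "unit_in A \<delta>" "D i = u ^ d * \<delta>"
    using prod_monomial[OF A, of i T u "n i"] T_mono unfolding D_def by fastforce
  have "T (Suc i) = u ^ d * \<delta> * Y i" unfolding T_eq \<delta>(2) by (simp add: mult_ac)
  \<comment> \<open>u and \<open>Y i\<close> are regular parameters, so u does not divide
    \<open>Y i\<close>: no exceptional factor is left in the strict transform.\<close>
  moreover have "Y i / u \<notin> A"
    using regular_params_not_nilpotent[OF reg, of 1] mem_principal_iff[OF u_nz] by simp
  ultimately show "strict_transform A u (T (Suc i)) (Y i)"
    unfolding strict_transform_def using bA \<delta>(1) by blast
qed

theorem quadratic_sequence: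
  obtains R u where "R 0 = S" "\<And>m. quadratic_transform \<nu> (R m) (R (Suc m))"
    "\<And>i. stage i (R (kseq p q i)) (u i)"
proof -
  obtain f where f: "\<And>i. stage i (fst (f i)) (snd (f i)) \<and> (i = 0 \<longrightarrow> f i = (S, x))"
    "\<And>i. (quadratic_transform \<nu> ^^ eps (p (Suc i)) (q (Suc i))) (fst (f i)) (fst (f (Suc i)))"
  \<comment> \<open>\<open>stage_Suc\<close> only asserts existence, hence dependent choice; the
    clause for i = 0 pins the sequence to start at (S, x).\<close>
  proof (rule exE[OF dependent_nat_choice[of "\<lambda>i z. stage i (fst z) (snd z) \<and> (i = 0 \<longrightarrow> z = (S, x))"
      "\<lambda>i z z'. (quadratic_transform \<nu> ^^ eps (p (Suc i)) (q (Suc i))) (fst z) (fst z')"]])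
    show "\<exists>z. stage 0 (fst z) (snd z) \<and> (0 = (0::nat) \<longrightarrow> z = (S, x))"
      using stage_0 by auto
    fix z i assume "stage i (fst z) (snd z) \<and> (i = 0 \<longrightarrow> z = (S, x))"
    then show "\<exists>z'. (stage (Suc i) (fst z') (snd z') \<and> (Suc i = 0 \<longrightarrow> z' = (S, x))) \<and>
        (quadratic_transform \<nu> ^^ eps (p (Suc i)) (q (Suc i))) (fst z) (fst z')"
      using stage_Suc[of i "fst z" "snd z"] by auto
  qed blast
  obtain R where R: "\<And>i. R (kseq p q i) = fst (f i)" "\<And>m. quadratic_transform \<nu> (R m) (R (Suc m))"
    using glue_chains[where E = "quadratic_transform \<nu>" and d = "\<lambda>i. eps (p (Suc i)) (q (Suc i))"
        and A = "\<lambda>i. fst (f i)" and K = "kseq p q"]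
      f(2) eps_pos p_q by (metis kseq.simps)
  show ?thesis
    using that[of R "\<lambda>i. snd (f i)"] R f(1) by (metis fst_conv kseq.simps(1))
qed

end

lemma algebraic_local_ring_base:
  assumes "algebraic_local_ring k S"
  shows "k \<subseteq> S"
proof -
  obtain F P where FP: "prime_ideal P (gen_subring (k \<union> F))" "S = localization (gen_subring (k \<union> F)) P"
    using assms unfolding algebraic_local_ring_def by blast
  let ?B = "gen_subring (k \<union> F)"
  have kB: "k \<subseteq> ?B" by (auto simp: gen_subring_def)
  have one: "1 \<in> ?B" "1 \<notin> P" using FP(1) by (auto simp: gen_subring_def subring_def prime_ideal_def)
  show ?thesis
  proof
    fix c assume "c \<in> k"
    then have "c = c / 1" "c \<in> ?B" using kB by auto
    then show "c \<in> S" unfolding FP(2) localization_def using one by blast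
  qed
qed

theorem theorem7p5:
  fixes k :: "'a::field_char_0 set" and \<nu> :: "'a \<Rightarrow> rat" and S :: "'a set"
    and x y :: 'a and T lam :: "nat \<Rightarrow> 'a" and p q :: "nat \<Rightarrow> nat" and n :: "nat \<Rightarrow> nat \<Rightarrow> nat"
  assumes "alg_closed_subfield k"
    and "function_field_trdeg2 k"
    and "k_valuation k \<nu>"
    and "residue_field_k \<nu> k"
    and "regular_params S x y"
    and "algebraic_local_ring k S"
    and "quotient_field_is_UNIV S"
    and "dominated S \<nu>"
    and "\<nu> x = 1"
    and "jumping_polys k \<nu> x y T p q n lam"
  shows "\<exists>R :: nat \<Rightarrow> 'a set. R 0 = S \<and> (\<forall>m. quadratic_transform \<nu> (R m) (R (Suc m))) \<and>
    (\<forall>i\<ge>1. free (R (kseq p q i)) x \<and>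
      (\<exists>xi yi. regular_params (R (kseq p q i)) xi yi \<and> exceptional (R (kseq p q i)) x xi \<and>
         (\<forall>j\<le>i. \<exists>\<gamma> (e::nat). unit_in (R (kseq p q i)) \<gamma> \<and>
              of_nat e = of_nat (Qp q i) * \<nu> (T j) \<and> T j = xi ^ e * \<gamma>) \<and>
         \<nu> xi = 1 / of_nat (Qp q i) \<and>
         yi = T (Suc i) / (\<Prod>j<i. T j ^ n i j) \<and>
         strict_transform (R (kseq p q i)) xi (T (Suc i)) yi \<and>
         \<nu> yi = (1 / of_nat (Qp q i)) * (of_nat (p (Suc i)) / of_nat (q (Suc i)))))"
proof -
  interpret jumping_polynomials k \<nu> S x y T lam p q n
    using assms algebraic_local_ring_base by unfold_locales (auto simp: alg_closed_subfield_def)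
  obtain R u where R: "R 0 = S" "\<And>m. quadratic_transform \<nu> (R m) (R (Suc m))"
    "\<And>i. stage i (R (kseq p q i)) (u i)"
    using quadratic_sequence by blast
  show ?thesis
  proof (intro exI[of _ R] conjI allI impI, rule R(1), rule R(2))
    fix i :: nat
    note conclusion = stage_conclusion[OF R(3)[of i]]
    show "free (R (kseq p q i)) x" by (rule conclusion)
    show "\<exists>xi yi. regular_params (R (kseq p q i)) xi yi \<and> exceptional (R (kseq p q i)) x xi \<and>
         (\<forall>j\<le>i. \<exists>\<gamma> (e::nat). unit_in (R (kseq p q i)) \<gamma> \<and>
              of_nat e = of_nat (Qp q i) * \<nu> (T j) \<and> T j = xi ^ e * \<gamma>) \<and>
         \<nu> xi = 1 / of_nat (Qp q i) \<and>
         yi = T (Suc i) / (\<Prod>j<i. T j ^ n i j) \<and>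
         strict_transform (R (kseq p q i)) xi (T (Suc i)) yi \<and>
         \<nu> yi = (1 / of_nat (Qp q i)) * (of_nat (p (Suc i)) / of_nat (q (Suc i)))"
      by (intro exI[of _ "u i"] exI[of _ "Y i"] conjI conclusion \<nu>_Y) (simp add: Y_def D_def)
  qed
qed

end
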